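(* For a symmetric multicategory $\mathcal M$ the following are equivalent: 1. $\mathcal M$ is cartesian and has algebraic products (of all finite families of objects). 2. $\mathcal M$ is cartesian and has finite universal products. 3. $\mathcal M$ is cartesian and representable. 4. $\mathcal M$ is cartesian monoidal, that is $\mathcal M\cong\mathcal C_\times$ for a category $\mathcal C$ with finite products.
   Context: A cartesian structure on a multicategory $\mathcal M$ assigns, to every mapping $\sigma:\{1,\dots,n\}\to\{1,\dots,m\}$ and sequences of objects $A_1,\dots,A_n$ and $B_1,\dots,B_m$ with $B_{\sigma i}=A_i$, and every object $C$, a mapping $f\mapsto\sigma f$, $\mathcal M(A_1,\dots,A_n;C)\to\mathcal M(B_1,\dots,B_m;C)$, functorially ($\mathrm{id}f=f$, $\rho(\sigma f)=(\rho\sigma)f$) and compatibly with composition: (i) $f(\sigma_1f_1,\dots,\sigma_nf_n)=(\sigma_1+\cdots+\sigma_n)f(f_1,\dots,f_n)$, where $+$ is juxtaposition of mappings; (ii) $(\sigma f)(f_1,\dots,f_m)=\sigma'\big(f(f_{\sigma1},\dots,f_{\sigma n})\big)$, where $\sigma'$ maps the $k$-th place of the $i$-th block (the domain of $f_{\sigma i}$) to the $k$-th place of the $(\sigma i)$-th block of the concatenated domains of $f_1,\dots,f_m$. A symmetric structure is defined in the same way using only bijective $\sigma$. "$\mathcal M$ is cartesian" means that the symmetric structure of $\mathcal M$ extends to a cartesian structure (with respect to which algebraic products are taken). An algebraic product of $A_1,\dots,A_n$ ($n\ge0$) is an object $C$ with arrows $p_i:C\to A_i$ and $u:A_1,\dots,A_n\to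 C$ such that $\gamma\big(u(p_1,\dots,p_n)\big)=\mathrm{id}_C$, where $\gamma:\mathcal M(C,\dots,C;C)\to\mathcal M(C;C)$ is the action of the unique map $\{1,\dots,n\}\to\{1\}$, and $p_i\,u=\iota_i\,\mathrm{id}_{A_i}$ for each $i$, where $\iota_i:\mathcal M(A_i;A_i)\to\mathcal M(A_1,\dots,A_n;A_i)$ is the action of the map $\{1\}\to\{1,\dots,n\}$, $1\mapsto i$. A universal product of $A_1,\dots,A_n$ is an object $C$ with arrows $p_i:C\to A_i$ such that for every sequence $X_1,\dots,X_k$ ($k\ge 0$) and arrows $f_i:X_1,\dots,X_k\to A_i$ ($1\le i\le n$) there is a unique $t:X_1,\dots,X_k\to C$ with $p_it=f_i$ for all $i$. An arrow $u:A_1,\dots,A_n\to C$ is preuniversal if composition with $u$ gives a bijection $\mathcal M(C;B)\to\mathcal M(A_1,\dots,A_n;B)$ for every object $B$. $\mathcal M$ is representable if every finite sequence of objects is the domain of a preuniversal arrow and preuniversal arrows are closed under composition. For a category $\mathcal C$ with (chosen) finite products, $\mathcal C_\times$ is the symmetric multicategory with the objects of $\mathcal C$ and $\mathcal C_\times(A_1,\dots,A_n;A)=\mathcal C(A_1\times\cdots\times A_n;A)$, with the obvious composition and symmetric structure. *)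

theory Defs
  imports Main
begin

section \<open>Multicategories\<close>

text \<open>
  Arrows form a single set with source and target functions, so that the hom-sets of one
  multicategory are pairwise disjoint; this is the usual harmless normalisation.
  Laws are required only on objects, arrows and composable families.
\<close>

record ('o, 'a) multicategory =
  obj :: "'o set"
  arr :: "'a set"
  src :: "'a \<Rightarrow> 'o list"
  trg :: "'a \<Rightarrow> 'o"
  ident :: "'o \<Rightarrow> 'a"
  mcomp :: "'a \<Rightarrow> 'a list \<Rightarrow> 'a"

definition hom :: "('o, 'a, 'z) multicategory_scheme \<Rightarrow> 'o list \<Rightarrow> 'o \<Rightarrow> 'a set" where
  "hom M As B = {f \<in> arr M. src M f = As \<and> trg M f = B}"

definition composable :: "('o, 'a, 'z) multicategory_scheme \<Rightarrow> 'a \<Rightarrow> 'a list \<Rightarrow> bool" where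
  "composable M f fs \<longleftrightarrow> f \<in> arr M \<and> set fs \<subseteq> arr M \<and> map (trg M) fs = src M f"

locale multicategory =
  fixes M :: "('o, 'a, 'z) multicategory_scheme"
  assumes src_obj: "f \<in> arr M \<Longrightarrow> set (src M f) \<subseteq> obj M"
    and trg_obj: "f \<in> arr M \<Longrightarrow> trg M f \<in> obj M"
    and ident_hom: "A \<in> obj M \<Longrightarrow> ident M A \<in> hom M [A] A"
    and mcomp_hom: "composable M f fs \<Longrightarrow>
          mcomp M f fs \<in> hom M (concat (map (src M) fs)) (trg M f)"
    and ident_left: "f \<in> arr M \<Longrightarrow> mcomp M (ident M (trg M f)) [f] = f"
    and ident_right: "f \<in> arr M \<Longrightarrow> mcomp M f (map (ident M) (src M f)) = f"
    and mcomp_assoc: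
      "composable M f fs \<Longrightarrow> length gss = length fs \<Longrightarrow>
       (\<And>i. i < length fs \<Longrightarrow> composable M (fs ! i) (gss ! i)) \<Longrightarrow>
       mcomp M f (map2 (mcomp M) fs gss) = mcomp M (mcomp M f fs) (concat gss)"


section \<open>Symmetric and cartesian structures\<close>

text \<open>
  A mapping from an n-element to an m-element initial segment is encoded, with indices starting
  at 0, as the list \<open>\<sigma>\<close> of its n values, all of them less than m.  Thus the composite of
  \<open>\<sigma>\<close> followed by \<open>\<rho>\<close> is \<open>map ((!) \<rho>) \<sigma>\<close>.  The number m is not determined by \<open>\<sigma>\<close>; it is the
  length of the sequence \<open>Bs\<close>, which is an explicit argument of the action.
\<close>

definition is_bijection :: "nat list \<Rightarrow> nat \<Rightarrow> bool" where
  "is_bijection \<sigma> m \<longleftrightarrow> distinct \<sigma> \<and> set \<sigma> = {..<m}"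

definition is_mapping :: "nat list \<Rightarrow> nat \<Rightarrow> bool" where
  "is_mapping \<sigma> m \<longleftrightarrow> set \<sigma> \<subseteq> {..<m}"

definition offset :: "nat list \<Rightarrow> nat \<Rightarrow> nat" where
  "offset ms i = sum_list (take i ms)"

text \<open>The positions of the \<open>i\<close>-th block in a concatenation of blocks of lengths \<open>ms\<close>.\<close>

definition block :: "nat list \<Rightarrow> nat \<Rightarrow> nat list" where
  "block ms i = [offset ms i ..< offset ms i + ms ! i]"

text \<open>Juxtaposition of the mappings \<open>\<sigma>s ! i\<close>, whose codomains have sizes \<open>ms ! i\<close>.\<close>

definition juxtapose :: "nat list \<Rightarrow> nat list list \<Rightarrow> nat list" where
  "juxtapose ms \<sigma>s = concat (map (\<lambda>i. map (\<lambda>k. offset ms i + k) (\<sigma>s ! i)) [0..<length \<sigma>s])"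

text \<open>
  The mapping \<open>\<sigma>'\<close> induced on blocks of lengths \<open>ms\<close>: it sends the \<open>k\<close>-th place of the
  \<open>i\<close>-th block (a copy of block \<open>\<sigma> ! i\<close>) to the \<open>k\<close>-th place of the \<open>(\<sigma> ! i)\<close>-th block.
\<close>

definition block_mapping :: "nat list \<Rightarrow> nat list \<Rightarrow> nat list" where
  "block_mapping ms \<sigma> = concat (map (block ms) \<sigma>)"

text \<open>\<open>K \<sigma> m\<close> says which mappings \<open>\<sigma>\<close> into an m-element segment are allowed to act.\<close>

definition acts_on :: "('o, 'a, 'z) multicategory_scheme \<Rightarrow> (nat list \<Rightarrow> nat \<Rightarrow> bool)
    \<Rightarrow> nat list \<Rightarrow> 'o list \<Rightarrow> 'a \<Rightarrow> bool" where
  "acts_on M K \<sigma> Bs f \<longleftrightarrow>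
     f \<in> arr M \<and> set Bs \<subseteq> obj M \<and> K \<sigma> (length Bs) \<and> map ((!) Bs) \<sigma> = src M f"

locale mapping_action = multicategory M
  for M :: "('o, 'a, 'z) multicategory_scheme" +
  fixes K :: "nat list \<Rightarrow> nat \<Rightarrow> bool"
    and act :: "nat list \<Rightarrow> 'o list \<Rightarrow> 'a \<Rightarrow> 'a"
  assumes act_hom: "acts_on M K \<sigma> Bs f \<Longrightarrow> act \<sigma> Bs f \<in> hom M Bs (trg M f)"
    and act_id: "f \<in> arr M \<Longrightarrow> act [0..<length (src M f)] (src M f) f = f"
    and act_act: "acts_on M K \<sigma> Bs f \<Longrightarrow> acts_on M K \<rho> Cs (act \<sigma> Bs f) \<Longrightarrow>
          act \<rho> Cs (act \<sigma> Bs f) = act (map ((!) \<rho>) \<sigma>) Cs f"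
    and mcomp_act_right:
      "composable M f fs \<Longrightarrow> length \<sigma>s = length fs \<Longrightarrow> length Bss = length fs \<Longrightarrow>
       (\<And>i. i < length fs \<Longrightarrow> acts_on M K (\<sigma>s ! i) (Bss ! i) (fs ! i)) \<Longrightarrow>
       mcomp M f (map (\<lambda>i. act (\<sigma>s ! i) (Bss ! i) (fs ! i)) [0..<length fs]) =
         act (juxtapose (map length Bss) \<sigma>s) (concat Bss) (mcomp M f fs)"
    and mcomp_act_left:
      "acts_on M K \<sigma> Bs f \<Longrightarrow> set fs \<subseteq> arr M \<Longrightarrow> map (trg M) fs = Bs \<Longrightarrow>
       mcomp M (act \<sigma> Bs f) fs =
         act (block_mapping (map (\<lambda>g. length (src M g)) fs) \<sigma>) (concat (map (src M) fs))
           (mcomp M f (map ((!) fs) \<sigma>))"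

record ('o, 'a) symmetric_multicategory = "('o, 'a) multicategory" +
  perm :: "nat list \<Rightarrow> 'o list \<Rightarrow> 'a \<Rightarrow> 'a"

locale symmetric_multicategory = mapping_action M is_bijection "perm M"
  for M :: "('o, 'a, 'z) symmetric_multicategory_scheme"

text \<open>A cartesian structure extending the given symmetric structure.\<close>

definition cartesian_structure :: "('o, 'a, 'z) symmetric_multicategory_scheme
    \<Rightarrow> (nat list \<Rightarrow> 'o list \<Rightarrow> 'a \<Rightarrow> 'a) \<Rightarrow> bool" where
  "cartesian_structure M act \<longleftrightarrow>
     mapping_action M is_mapping act \<and>
     (\<forall>\<sigma> Bs f. acts_on M is_bijection \<sigma> Bs f \<longrightarrow> act \<sigma> Bs f = perm M \<sigma> Bs f)"

definition is_cartesian :: "('o, 'a, 'z) symmetric_multicategory_scheme \<Rightarrow> bool" where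
  "is_cartesian M \<longleftrightarrow> (\<exists>act. cartesian_structure M act)"


section \<open>Products and representability\<close>

definition algebraic_product :: "('o, 'a, 'z) multicategory_scheme
    \<Rightarrow> (nat list \<Rightarrow> 'o list \<Rightarrow> 'a \<Rightarrow> 'a) \<Rightarrow> 'o list \<Rightarrow> 'o \<Rightarrow> 'a list \<Rightarrow> 'a \<Rightarrow> bool" where
  "algebraic_product M act As C ps u \<longleftrightarrow>
     C \<in> obj M \<and>
     length ps = length As \<and>
     (\<forall>i < length As. ps ! i \<in> hom M [C] (As ! i)) \<and>
     u \<in> hom M As C \<and>
     act (replicate (length As) 0) [C] (mcomp M u ps) = ident M C \<and>
     (\<forall>i < length As. mcomp M (ps ! i) [u] = act [i] As (ident M (As ! i)))"

definition has_algebraic_products :: "('o, 'a, 'z) multicategory_scheme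
    \<Rightarrow> (nat list \<Rightarrow> 'o list \<Rightarrow> 'a \<Rightarrow> 'a) \<Rightarrow> bool" where
  "has_algebraic_products M act \<longleftrightarrow>
     (\<forall>As. set As \<subseteq> obj M \<longrightarrow> (\<exists>C ps u. algebraic_product M act As C ps u))"

definition universal_product :: "('o, 'a, 'z) multicategory_scheme
    \<Rightarrow> 'o list \<Rightarrow> 'o \<Rightarrow> 'a list \<Rightarrow> bool" where
  "universal_product M As C ps \<longleftrightarrow>
     C \<in> obj M \<and>
     length ps = length As \<and>
     (\<forall>i < length As. ps ! i \<in> hom M [C] (As ! i)) \<and>
     (\<forall>Xs fs. set Xs \<subseteq> obj M \<and> length fs = length As \<and>
        (\<forall>i < length As. fs ! i \<in> hom M Xs (As ! i)) \<longrightarrow>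
        (\<exists>!t. t \<in> hom M Xs C \<and> (\<forall>i < length As. mcomp M (ps ! i) [t] = fs ! i)))"

definition has_universal_products :: "('o, 'a, 'z) multicategory_scheme \<Rightarrow> bool" where
  "has_universal_products M \<longleftrightarrow>
     (\<forall>As. set As \<subseteq> obj M \<longrightarrow> (\<exists>C ps. universal_product M As C ps))"

definition preuniversal :: "('o, 'a, 'z) multicategory_scheme \<Rightarrow> 'a \<Rightarrow> bool" where
  "preuniversal M u \<longleftrightarrow>
     u \<in> arr M \<and>
     (\<forall>B \<in> obj M. bij_betw (\<lambda>g. mcomp M g [u]) (hom M [trg M u] B) (hom M (src M u) B))"

definition representable :: "('o, 'a, 'z) multicategory_scheme \<Rightarrow> bool" where
  "representable M \<longleftrightarrow>
     (\<forall>As. set As \<subseteq> obj M \<longrightarrow> (\<exists>u. preuniversal M u \<and> src M u = As)) \<and>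
     (\<forall>u us. composable M u us \<and> preuniversal M u \<and> (\<forall>v \<in> set us. preuniversal M v) \<longrightarrow>
        preuniversal M (mcomp M u us))"


section \<open>Categories with finite products and their multicategories\<close>

record ('o, 'a) category =
  cobj :: "'o set"
  carr :: "'a set"
  cdom :: "'a \<Rightarrow> 'o"
  ccod :: "'a \<Rightarrow> 'o"
  cident :: "'o \<Rightarrow> 'a"
  ccomp :: "'a \<Rightarrow> 'a \<Rightarrow> 'a"

definition chom :: "('o, 'a, 'z) category_scheme \<Rightarrow> 'o \<Rightarrow> 'o \<Rightarrow> 'a set" where
  "chom C A B = {f \<in> carr C. cdom C f = A \<and> ccod C f = B}"

locale category =
  fixes C :: "('o, 'a, 'z) category_scheme"
  assumes cdom_obj: "f \<in> carr C \<Longrightarrow> cdom C f \<in> cobj C"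
    and ccod_obj: "f \<in> carr C \<Longrightarrow> ccod C f \<in> cobj C"
    and cident_hom: "A \<in> cobj C \<Longrightarrow> cident C A \<in> chom C A A"
    and ccomp_hom: "f \<in> chom C A B \<Longrightarrow> g \<in> chom C B D \<Longrightarrow> ccomp C g f \<in> chom C A D"
    and cident_left: "f \<in> chom C A B \<Longrightarrow> ccomp C (cident C B) f = f"
    and cident_right: "f \<in> chom C A B \<Longrightarrow> ccomp C f (cident C A) = f"
    and ccomp_assoc: "f \<in> chom C A B \<Longrightarrow> g \<in> chom C B D \<Longrightarrow> h \<in> chom C D E \<Longrightarrow>
          ccomp C h (ccomp C g f) = ccomp C (ccomp C h g) f"

definition is_product :: "('o, 'a, 'z) category_scheme
    \<Rightarrow> 'o list \<Rightarrow> 'o \<Rightarrow> 'a list \<Rightarrow> bool" where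
  "is_product C As P ps \<longleftrightarrow>
     P \<in> cobj C \<and>
     length ps = length As \<and>
     (\<forall>i < length As. ps ! i \<in> chom C P (As ! i)) \<and>
     (\<forall>X fs. X \<in> cobj C \<and> length fs = length As \<and>
        (\<forall>i < length As. fs ! i \<in> chom C X (As ! i)) \<longrightarrow>
        (\<exists>!t. t \<in> chom C X P \<and> (\<forall>i < length As. ccomp C (ps ! i) t = fs ! i)))"

text \<open>
  The choice of products is an arbitrary one, of a product for every finite sequence of objects;
  in particular the chosen product of \<open>[A]\<close> is only isomorphic to \<open>A\<close>.
\<close>

record ('o, 'a) fp_category = "('o, 'a) category" +
  product :: "'o list \<Rightarrow> 'o"
  projections :: "'o list \<Rightarrow> 'a list"

locale fp_category = category C
  for C :: "('o, 'a, 'z) fp_category_scheme" +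
  assumes product: "set As \<subseteq> cobj C \<Longrightarrow> is_product C As (product C As) (projections C As)"

definition tuple :: "('o, 'a, 'z) fp_category_scheme \<Rightarrow> 'o \<Rightarrow> 'o list \<Rightarrow> 'a list \<Rightarrow> 'a" where
  "tuple C X As fs = (THE t. t \<in> chom C X (product C As) \<and>
     (\<forall>i < length As. ccomp C (projections C As ! i) t = fs ! i))"

text \<open>
  The arrow from the product of \<open>Bs\<close> to the product of the sequence \<open>map ((!) Bs) \<sigma>\<close> whose
  \<open>i\<close>-th component is the projection number \<open>\<sigma> ! i\<close>.
\<close>

definition reindexing :: "('o, 'a, 'z) fp_category_scheme \<Rightarrow> nat list \<Rightarrow> 'o list \<Rightarrow> 'a" where
  "reindexing C \<sigma> Bs =
     tuple C (product C Bs) (map ((!) Bs) \<sigma>) (map ((!) (projections C Bs)) \<sigma>)"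

text \<open>
  The multicategory \<open>\<C>\<^sub>\<times>\<close>.  An arrow is a pair of its source sequence \<open>As\<close> and an arrow of \<open>C\<close>
  whose domain is the chosen product of \<open>As\<close>; the sequence is part of the arrow because
  different sequences may have the same chosen product.  Identities are projections because the
  product of \<open>[A]\<close> need not be \<open>A\<close>.  The composite of \<open>g\<close> with \<open>f\<^sub>1, \<dots>, f\<^sub>n\<close> is \<open>g\<close> after the
  arrow that applies \<open>f\<^sub>j\<close> to the \<open>j\<close>-th block of the product of the concatenated sources.
\<close>

definition times_comp :: "('o, 'a, 'z) fp_category_scheme
    \<Rightarrow> 'o list \<times> 'a \<Rightarrow> ('o list \<times> 'a) list \<Rightarrow> 'o list \<times> 'a" where
  "times_comp C g fs =
     (let Xs = concat (map fst fs); ms = map (\<lambda>f. length (fst f)) fs in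
      (Xs, ccomp C (snd g) (tuple C (product C Xs) (fst g)
         (map (\<lambda>j. ccomp C (snd (fs ! j)) (reindexing C (block ms j) Xs)) [0..<length fs]))))"

definition times_multicategory :: "('o, 'a, 'z) fp_category_scheme
    \<Rightarrow> ('o, 'o list \<times> 'a) symmetric_multicategory" where
  "times_multicategory C =
     \<lparr> obj = cobj C,
       arr = {(As, f). set As \<subseteq> cobj C \<and> f \<in> carr C \<and> cdom C f = product C As},
       src = fst,
       trg = (\<lambda>f. ccod C (snd f)),
       ident = (\<lambda>A. ([A], projections C [A] ! 0)),
       mcomp = times_comp C,
       perm = (\<lambda>\<sigma> Bs f. (Bs, ccomp C (snd f) (reindexing C \<sigma> Bs))) \<rparr>"

text \<open>Isomorphism of symmetric multicategories.\<close>

definition isomorphic :: "('o, 'a, 'z) symmetric_multicategory_scheme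
    \<Rightarrow> ('p, 'b, 'y) symmetric_multicategory_scheme \<Rightarrow> bool" where
  "isomorphic M N \<longleftrightarrow> (\<exists>F G.
     bij_betw F (obj M) (obj N) \<and>
     bij_betw G (arr M) (arr N) \<and>
     (\<forall>f \<in> arr M. src N (G f) = map F (src M f) \<and> trg N (G f) = F (trg M f)) \<and>
     (\<forall>A \<in> obj M. G (ident M A) = ident N (F A)) \<and>
     (\<forall>f fs. composable M f fs \<longrightarrow> G (mcomp M f fs) = mcomp N (G f) (map G fs)) \<and>
     (\<forall>\<sigma> Bs f. acts_on M is_bijection \<sigma> Bs f \<longrightarrow>
        G (perm M \<sigma> Bs f) = perm N \<sigma> (map F Bs) (G f)))"

end

theory Submission
  imports Defs
begin

text \<open>
  In a cartesian multicategory every arrow \<open>h\<close> can be composed with a family of arrows out of a common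
  sequence \<open>Xs\<close>, by contracting the copies of \<open>Xs\<close>; the projections \<open>\<iota>\<^sub>i id\<close> behave like variables for
  this substitution.  For an algebraic product, substituting the projections into \<open>u\<close> gives the identity, and \<open>p\<^sub>i u\<close> is the \<open>i\<close>-th variable.
  Hence \<open>t = u(f\<^sub>1, \<dots>, f\<^sub>n)\<close> (contracted) is the unique tuple, \<open>h \<mapsto> h(p\<^sub>1, \<dots>, p\<^sub>n)\<close> (contracted)
  inverts composition with \<open>u\<close>, and conversely the \<open>p\<^sub>i\<close> of a preuniversal \<open>u\<close> are obtained by
  factoring the variables through \<open>u\<close>.  Preuniversal arrows compose because products of products are
  products of the concatenated families.  Finally the unary arrows form a category with finite
  products, and factoring an arrow through \<open>u\<close> is the isomorphism with its multicategory.
\<close>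

section \<open>Positions in concatenated lists\<close>

text \<open>Conditions 2 and 3 do not mention the action, whereas condition 1 takes its products
  with respect to one. Each comparison is therefore proved for an arbitrary fixed action, and having
  algebraic products turns out not to depend on its choice. Closure of preuniversal arrows under
  composition resists a direct attack: undoing the inner arrows one at a time would require
  factoring in the presence of further arguments, while preuniversality speaks only of arrows out of
  a single object. Products avoid this, because they are tested by cones with an arbitrary common
  source. In \<open>N\<close>, and in its comparison with \<open>M\<close>, arrows into products are
  compared by components. Every law then becomes an identity between lists of positions, which is
  what the list lemmas supply. The chosen product of \<open>[A]\<close> may differ from
  \<open>A\<close>, so an arrow of \<open>C\<close> becomes a unary arrow of \<open>N\<close> only
  after composition with the projection from that product. The way back from condition 4 transports
  both the action and the universal products of \<open>N\<close> along the isomorphism.\<close>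

lemma offset_0 [simp]: "offset ms 0 = 0"
  by (simp add: offset_def)

lemma offset_Cons_Suc [simp]: "offset (m # ms) (Suc i) = m + offset ms i"
  by (simp add: offset_def)

lemma block_Cons_0 [simp]: "block (m # ms) 0 = [0..<m]"
  by (simp add: block_def)

lemma block_Cons_Suc [simp]: "block (m # ms) (Suc i) = map ((+) m) (block ms i)"
  by (rule nth_equalityI) (simp_all add: block_def)

lemma length_block [simp]: "length (block ms i) = ms ! i"
  by (simp add: block_def)

lemma nth_block [simp]: "k < ms ! i \<Longrightarrow> block ms i ! k = offset ms i + k"
  by (simp add: block_def)

lemma offset_length_concat_less:
  "j < length xss \<Longrightarrow> k < length (xss ! j) \<Longrightarrow>
    offset (map length xss) j + k < length (concat xss)"
proof (induction xss arbitrary: j)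
  case (Cons xs xss)
  then show ?case
    by (cases j) auto
qed simp

lemma nth_concat_offset:
  "j < length xss \<Longrightarrow> k < length (xss ! j) \<Longrightarrow>
    concat xss ! (offset (map length xss) j + k) = xss ! j ! k"
proof (induction xss arbitrary: j)
  case (Cons xs xss)
  then show ?case
    by (cases j) (auto simp: nth_append add.assoc)
qed simp

lemma set_block_subset:
  "j < length xss \<Longrightarrow> set (block (map length xss) j) \<subseteq> {..<length (concat xss)}"
  using offset_length_concat_less[of j xss]
  by (fastforce simp: in_set_conv_nth)

lemma map_nth_concat_block:
  "j < length xss \<Longrightarrow> map ((!) (concat xss)) (block (map length xss) j) = xss ! j"
  by (rule nth_equalityI) (simp_all add: nth_concat_offset)

lemma offset_append:
  "i \<le> length ms \<Longrightarrow> offset (ms @ ns) i = offset ms i"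
  "offset (ms @ ns) (length ms + i) = sum_list ms + offset ns i"
  by (simp_all add: offset_def)

lemma offset_add_less_sum_list: "k < length ms \<Longrightarrow> r < ms ! k \<Longrightarrow> offset ms k + r < sum_list ms"
proof (induction ms arbitrary: k)
  case (Cons m ms)
  then show ?case
    by (cases k) auto
qed simp

text \<open>The left side adds up everything that precedes entry \<open>k\<close> of list
  \<open>j\<close> in the flattened list: the totals of the earlier lists, then the first
  \<open>k\<close> entries of list \<open>j\<close>.\<close>

lemma offset_concat:
  "j < length nss \<Longrightarrow> k < length (nss ! j) \<Longrightarrow>
    offset (concat nss) (offset (map length nss) j + k) =
    offset (map sum_list nss) j + offset (nss ! j) k"
proof (induction nss arbitrary: j)
  case (Cons ns nss)
  then show ?case
    by (cases j) (auto simp: offset_append add.assoc)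
qed simp

text \<open>Associativity at the level of positions: cutting out a fine block directly agrees with
  cutting out the coarse block \<open>j\<close> and then the fine block \<open>k\<close> inside it.
  Associativity in \<open>N\<close> rests on this.\<close>

lemma block_concat:
  assumes "j < length nss" "k < length (nss ! j)"
  shows "block (concat nss) (offset (map length nss) j + k) =
    map ((!) (block (map sum_list nss) j)) (block (nss ! j) k)"
  by (rule nth_equalityI)
    (use assms offset_add_less_sum_list in \<open>simp_all add: nth_concat_offset offset_concat\<close>)

text \<open>Consecutive blocks abut, since each starts at the sum of the lengths before it. This
  identifies variables collected block by block with all variables of a concatenation.\<close>

lemma concat_blocks: "concat (map (block ms) [0..<length ms]) = [0..<sum_list ms]"
proof -
  have "concat (map (block ms) [0..<n]) = [0..<offset ms n]" if "n \<le> length ms" for n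
    using that
  proof (induction n)
    case (Suc n)
    then have "offset ms (Suc n) = offset ms n + ms ! n"
      by (simp add: offset_def take_Suc_conv_app_nth)
    then show ?case
      using Suc upt_add_eq_append[of 0 "offset ms n" "ms ! n"] by (simp add: block_def)
  qed simp
  then show ?thesis
    using order_refl by (fastforce simp: offset_def)
qed

lemma concat_concat: "concat (map concat xsss) = concat (concat xsss)"
  by (induction xsss) auto

section \<open>Positions under juxtaposition and block mappings\<close>

lemma juxtapose_singleton: "juxtapose [m] [\<sigma>] = \<sigma>"
  by (simp add: juxtapose_def map_idI)

text \<open>Typing of the right side of law (i): the offset of block \<open>i\<close> moves the
  values of \<open>\<sigma>s ! i\<close> into that block, where \<open>concat Bss\<close> has the
  same entries as \<open>Bss ! i\<close>.\<close>

lemma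
  assumes len: "length \<sigma>s = length Bss" "length Ass = length Bss"
    and \<sigma>s: "\<And>i. i < length Bss \<Longrightarrow> set (\<sigma>s ! i) \<subseteq> {..<length (Bss ! i)}"
    and Ass: "\<And>i. i < length Bss \<Longrightarrow> map ((!) (Bss ! i)) (\<sigma>s ! i) = Ass ! i"
  shows set_juxtapose_subset:
      "set (juxtapose (map length Bss) \<sigma>s) \<subseteq> {..<length (concat Bss)}"
    and map_nth_juxtapose:
      "map ((!) (concat Bss)) (juxtapose (map length Bss) \<sigma>s) = concat Ass"
proof -
  let ?o = "offset (map length Bss)"
  have pos: "?o i + k < length (concat Bss) \<and> concat Bss ! (?o i + k) = Bss ! i ! k"
    if "i < length Bss" "k \<in> set (\<sigma>s ! i)" for i k
    using offset_length_concat_less nth_concat_offset subsetD[OF \<sigma>s that(2)] that(1) by blast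
  show "set (juxtapose (map length Bss) \<sigma>s) \<subseteq> {..<length (concat Bss)}"
    unfolding juxtapose_def using pos len by fastforce
  show "map ((!) (concat Bss)) (juxtapose (map length Bss) \<sigma>s) = concat Ass"
    unfolding juxtapose_def map_concat
  proof (rule arg_cong[where f = concat], rule nth_equalityI)
    fix i assume "i < length (map (map ((!) (concat Bss)))
      (map (\<lambda>i. map ((+) (?o i)) (\<sigma>s ! i)) [0..<length \<sigma>s]))"
    then have i: "i < length Bss"
      using len by simp
    then show "map (map ((!) (concat Bss)))
        (map (\<lambda>i. map ((+) (?o i)) (\<sigma>s ! i)) [0..<length \<sigma>s]) ! i = Ass ! i"
      using pos[OF i] len by (simp flip: Ass[OF i])
  qed (use len in simp)
qed

text \<open>Two decompositions meet here: the domain is cut by the lengths of the mappings, while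
  the values are shifted by the codomain sizes \<open>ms\<close>. This matches components in law (i)
  for \<open>N\<close>.\<close>

lemma map_nth_juxtapose_block:
  assumes "j < length \<sigma>s"
  shows "map ((!) (juxtapose ms \<sigma>s)) (block (map length \<sigma>s) j) = map (\<lambda>k. offset ms j + k) (\<sigma>s ! j)"
proof -
  let ?xss = "map (\<lambda>i. map (\<lambda>k. offset ms i + k) (\<sigma>s ! i)) [0..<length \<sigma>s]"
  have "map length ?xss = map length \<sigma>s"
    by (rule nth_equalityI) simp_all
  moreover have "map ((!) (concat ?xss)) (block (map length ?xss) j) = ?xss ! j"
    by (rule map_nth_concat_block) (simp add: assms)
  ultimately show ?thesis
    using assms by (simp only: juxtapose_def) simp
qed

lemma block_mapping_singleton: "block_mapping ms [i] = block ms i"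
  by (simp add: block_mapping_def)

text \<open>Law (ii) turns the contraction of copies of one object into the contraction of copies of
  a whole sequence; this is its combinatorial part.\<close>

lemma block_mapping_replicate:
  "block_mapping [k] (replicate n 0) = concat (replicate n [0..<k])"
  by (simp add: block_mapping_def map_replicate_const)

text \<open>Typing of the right side of law (ii): reading \<open>concat xss\<close> along the block
  mapping lists, for each entry \<open>s\<close> of \<open>\<sigma>\<close>, one copy of block
  \<open>s\<close>.\<close>

lemma
  assumes \<sigma>: "\<And>s. s \<in> set \<sigma> \<Longrightarrow> s < length xss"
  shows set_block_mapping_subset:
      "set (block_mapping (map length xss) \<sigma>) \<subseteq> {..<length (concat xss)}"
    and map_nth_block_mapping:
      "map ((!) (concat xss)) (block_mapping (map length xss) \<sigma>) = concat (map ((!) xss) \<sigma>)"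
proof -
  show "set (block_mapping (map length xss) \<sigma>) \<subseteq> {..<length (concat xss)}"
    using set_block_subset \<sigma> unfolding block_mapping_def by fastforce
  show "map ((!) (concat xss)) (block_mapping (map length xss) \<sigma>) = concat (map ((!) xss) \<sigma>)"
    unfolding block_mapping_def map_concat map_map
    by (intro arg_cong[where f = concat] map_cong refl) (simp only: comp_def map_nth_concat_block \<sigma>)
qed

lemma map_nth_concat_replicate:
  "map ((!) Xs) (concat (replicate n [0..<length Xs])) = concat (replicate n Xs)"
  by (simp add: map_concat map_nth)


lemma list_all2_concat:
  "list_all2 (list_all2 P) xss yss \<Longrightarrow> list_all2 P (concat xss) (concat yss)"
  by (induction rule: list_all2_induct) (auto intro: list_all2_appendI)

text \<open>Cuts a cone on a concatenated family into cones on the single blocks, as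
  \<open>universal_product_concat\<close> requires.\<close>

lemma list_all2_concat_rightE:
  assumes "list_all2 P xs (concat yss)"
  obtains xss where "xs = concat xss" "list_all2 (list_all2 P) xss yss"
  using assms
proof (induction yss arbitrary: xs thesis)
  case (Cons ys yss)
  from Cons.prems(2) obtain us vs where "xs = us @ vs" "list_all2 P us ys" "list_all2 P vs (concat yss)"
    by (auto simp: list_all2_append2)
  with Cons.IH[of vs] Cons.prems(1) show ?case
    by (metis concat.simps(2) list.rel_intros(2))
qed simp


section \<open>Multicategories\<close>

lemma homI: "f \<in> arr M \<Longrightarrow> src M f = As \<Longrightarrow> trg M f = B \<Longrightarrow> f \<in> hom M As B"
  by (simp add: hom_def)

lemma homD:
  assumes "f \<in> hom M As B"
  shows "f \<in> arr M" "src M f = As" "trg M f = B"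
  using assms by (simp_all add: hom_def)

abbreviation cone :: "('o, 'a, 'z) multicategory_scheme \<Rightarrow> 'o list \<Rightarrow> 'a list \<Rightarrow> 'o list \<Rightarrow> bool"
  where "cone M Xs fs As \<equiv> list_all2 (\<lambda>f A. f \<in> hom M Xs A) fs As"

lemma cone_trg: "cone M Xs fs As \<Longrightarrow> map (trg M) fs = As"
  by (induction rule: list_all2_induct) (auto dest: homD)

lemma cone_src: "cone M Xs fs As \<Longrightarrow> map (src M) fs = replicate (length As) Xs"
  by (induction rule: list_all2_induct) (auto dest: homD)

lemma cone_arr: "cone M Xs fs As \<Longrightarrow> set fs \<subseteq> arr M"
  by (induction rule: list_all2_induct) (auto dest: homD)

lemma cone_composable: "h \<in> hom M As B \<Longrightarrow> cone M Xs fs As \<Longrightarrow> composable M h fs"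
  by (simp add: composable_def cone_trg cone_arr homD)

lemma composable_concat:
  assumes "length gss = length fs"
    "\<And>i. i < length fs \<Longrightarrow> composable M (fs ! i) (gss ! i)"
  shows "set (concat gss) \<subseteq> arr M" "map (trg M) (concat gss) = concat (map (src M) fs)"
proof -
  have "list_all2 (composable M) fs gss"
    using assms by (simp add: list_all2_conv_all_nth)
  then show "set (concat gss) \<subseteq> arr M" "map (trg M) (concat gss) = concat (map (src M) fs)"
    by (induction rule: list_all2_induct) (auto simp: composable_def)
qed

lemma acts_on_mappingD:
  assumes "acts_on M is_mapping \<sigma> Bs f"
  shows "set Bs \<subseteq> obj M" "set \<sigma> \<subseteq> {..<length Bs}" "map ((!) Bs) \<sigma> = src M f" "f \<in> arr M"
  using assms by (simp_all add: acts_on_def is_mapping_def)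

lemma acts_on_mappingI:
  assumes "f \<in> hom M As B" "set Bs \<subseteq> obj M" "set \<sigma> \<subseteq> {..<length Bs}" "map ((!) Bs) \<sigma> = As"
  shows "acts_on M is_mapping \<sigma> Bs f"
  using assms by (simp add: acts_on_def is_mapping_def hom_def)

lemma map_nth_map:
  assumes "set \<sigma> \<subseteq> {..<length xs}"
  shows "map ((!) (map g xs)) \<sigma> = map g (map ((!) xs) \<sigma>)"
  using assms by (auto simp: subset_iff)

text \<open>The action in law (i) is legitimate. Phrased for any multicategory record, this serves
  both \<open>N\<close> and the transported action.\<close>

lemma acts_on_juxtapose:
  assumes len: "length \<sigma>s = length fs" "length Bss = length fs"
    and act: "\<And>i. i < length fs \<Longrightarrow> acts_on M is_mapping (\<sigma>s ! i) (Bss ! i) (fs ! i)"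
  shows "set (concat Bss) \<subseteq> obj M"
    "set (juxtapose (map length Bss) \<sigma>s) \<subseteq> {..<length (concat Bss)}"
    "map ((!) (concat Bss)) (juxtapose (map length Bss) \<sigma>s) = concat (map (src M) fs)"
proof -
  have "set Bs \<subseteq> obj M" if "Bs \<in> set Bss" for Bs
    using acts_on_mappingD(1)[OF act] len that by (metis in_set_conv_nth)
  then show "set (concat Bss) \<subseteq> obj M"
    by auto
qed (use set_juxtapose_subset[of \<sigma>s Bss "map (src M) fs"]
    map_nth_juxtapose[of \<sigma>s Bss "map (src M) fs"] acts_on_mappingD[OF act] len in simp_all)

text \<open>The counterpart for law (ii), needed for the transported action.\<close>

lemma acts_on_block_mapping:
  assumes f: "acts_on M is_mapping \<sigma> Bs f" and Bs: "map (trg M) fs = Bs"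
  shows "set (block_mapping (map (\<lambda>g. length (src M g)) fs) \<sigma>) \<subseteq> {..<length (concat (map (src M) fs))}"
    "map ((!) (concat (map (src M) fs))) (block_mapping (map (\<lambda>g. length (src M g)) fs) \<sigma>) =
      concat (map (src M) (map ((!) fs) \<sigma>))"
    "s \<in> set \<sigma> \<Longrightarrow> s < length fs"
    "map (trg M) (map ((!) fs) \<sigma>) = src M f"
proof -
  note \<sigma> = acts_on_mappingD[OF f]
  have *: "s < length fs" if "s \<in> set \<sigma>" for s
    using subsetD[OF \<sigma>(2) that] Bs by auto
  then show "s \<in> set \<sigma> \<Longrightarrow> s < length fs" .
  have "set \<sigma> \<subseteq> {..<length fs}"
    using * by auto
  note nth = map_nth_map[OF this]
  show "map (trg M) (map ((!) fs) \<sigma>) = src M f"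
    using \<sigma>(3) unfolding nth[symmetric] Bs .
  show "set (block_mapping (map (\<lambda>g. length (src M g)) fs) \<sigma>) \<subseteq> {..<length (concat (map (src M) fs))}"
    using set_block_mapping_subset[of \<sigma> "map (src M) fs"] * by (simp only: map_map comp_def length_map)
  show "map ((!) (concat (map (src M) fs))) (block_mapping (map (\<lambda>g. length (src M g)) fs) \<sigma>) =
      concat (map (src M) (map ((!) fs) \<sigma>))"
    using map_nth_block_mapping[of \<sigma> "map (src M) fs"] *
    unfolding nth[symmetric] by (simp only: map_map comp_def length_map)
qed

context multicategory
begin

lemma mcomp_unary_hom:
  assumes "g \<in> hom M [A] B" "f \<in> hom M As A"
  shows "mcomp M g [f] \<in> hom M As B"
  using mcomp_hom[of g "[f]"] assms by (simp add: hom_def composable_def)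

lemma mcomp_unary_assoc:
  assumes "g \<in> hom M [A] B" "f \<in> hom M As A" "composable M f hs"
  shows "mcomp M (mcomp M g [f]) hs = mcomp M g [mcomp M f hs]"
  using mcomp_assoc[of g "[f]" "[hs]"] assms by (simp add: hom_def composable_def)

lemma mcomp_ident_unary: "f \<in> hom M As A \<Longrightarrow> mcomp M (ident M A) [f] = f"
  using ident_left[of f] by (simp add: hom_def)

lemma mcomp_unary_ident: "f \<in> hom M [A] B \<Longrightarrow> mcomp M f [ident M A] = f"
  using ident_right[of f] by (simp add: hom_def)

lemma hom_obj:
  assumes "f \<in> hom M As B"
  shows "set As \<subseteq> obj M" "B \<in> obj M"
  using src_obj[of f] trg_obj[of f] assms by (simp_all add: hom_def)

section \<open>Universal products in a multicategory\<close>

lemma universal_product_proj: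
  assumes "universal_product M As C ps"
  shows "C \<in> obj M" "cone M [C] ps As"
  using assms by (simp_all add: universal_product_def list_all2_conv_all_nth)

text \<open>Comparing components as one equation between lists lets later proofs split and flatten
  families with \<open>map\<close> and \<open>concat\<close> instead of tracking indices.\<close>

lemma universal_product_iff:
  "universal_product M As C ps \<longleftrightarrow> C \<in> obj M \<and> cone M [C] ps As \<and>
    (\<forall>Xs fs. set Xs \<subseteq> obj M \<longrightarrow> cone M Xs fs As \<longrightarrow>
      (\<exists>!t. t \<in> hom M Xs C \<and> map (\<lambda>p. mcomp M p [t]) ps = fs))"
proof -
  have "map (\<lambda>p. mcomp M p [t]) ps = fs \<longleftrightarrow> (\<forall>i < length As. mcomp M (ps ! i) [t] = fs ! i)"
    if "length ps = length As" "length fs = length As" for t fs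
    using that by (simp add: list_eq_iff_nth_eq)
  then show ?thesis
    by (simp add: universal_product_def list_all2_conv_all_nth imp_conjL cong: conj_cong)
qed

lemma cone_mcomp:
  assumes "cone M [C] ps As" "t \<in> hom M Xs C"
  shows "cone M Xs (map (\<lambda>p. mcomp M p [t]) ps) As"
  using assms mcomp_unary_hom by (auto simp: list_all2_conv_all_nth)

lemma universal_product_ext:
  assumes "universal_product M As C ps"
    and t: "t \<in> hom M Xs C" and t': "t' \<in> hom M Xs C"
    and "map (\<lambda>p. mcomp M p [t]) ps = map (\<lambda>p. mcomp M p [t']) ps"
  shows "t = t'"
proof -
  have "cone M Xs (map (\<lambda>p. mcomp M p [t]) ps) As"
    using cone_mcomp universal_product_proj[OF assms(1)] t by blast
  then show ?thesis
    using assms hom_obj[OF t] unfolding universal_product_iff by metis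
qed

lemma universal_product_exists:
  assumes "universal_product M As C ps" "set Xs \<subseteq> obj M" "cone M Xs fs As"
  obtains t where "t \<in> hom M Xs C" "map (\<lambda>p. mcomp M p [t]) ps = fs"
  using assms unfolding universal_product_iff by metis

lemma universal_productI:
  assumes "C \<in> obj M" "cone M [C] ps As"
    and "\<And>Xs fs. set Xs \<subseteq> obj M \<Longrightarrow> cone M Xs fs As \<Longrightarrow>
      \<exists>t. t \<in> hom M Xs C \<and> map (\<lambda>p. mcomp M p [t]) ps = fs"
    and "\<And>Xs t t'. t \<in> hom M Xs C \<Longrightarrow> t' \<in> hom M Xs C \<Longrightarrow>
      map (\<lambda>p. mcomp M p [t]) ps = map (\<lambda>p. mcomp M p [t']) ps \<Longrightarrow> t = t'"
  shows "universal_product M As C ps"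
  unfolding universal_product_iff
proof (intro conjI allI impI)
  fix Xs fs
  assume "set Xs \<subseteq> obj M" "cone M Xs fs As"
  then show "\<exists>!t. t \<in> hom M Xs C \<and> map (\<lambda>p. mcomp M p [t]) ps = fs"
    using assms(3)[of Xs fs] assms(4)[of _ Xs] by blast
qed (use assms(1,2) in auto)

text \<open>A cone on the flattened family is cut at the blocks; each piece factors through its
  \<open>Cs ! j\<close>, and these factors form a cone that factors through \<open>C\<close>. This
  is the part of the closure of preuniversal arrows that concerns products.\<close>

lemma universal_product_concat:
  assumes C: "universal_product M Cs C ps"
    and len: "length Ass = length Cs" "length pss = length Cs"
    and Cs: "\<And>j. j < length Cs \<Longrightarrow> universal_product M (Ass ! j) (Cs ! j) (pss ! j)"
  shows "universal_product M (concat Ass) C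
    (concat (map2 (\<lambda>qs p. map (\<lambda>q. mcomp M q [p]) qs) pss ps))"
    (is "universal_product M _ _ (concat ?rss)")
proof -
  let ?pr = "\<lambda>t. map (\<lambda>p. mcomp M p [t])"
  have p: "cone M [C] ps Cs"
    using universal_product_proj[OF C] by blast
  have lenp: "length ps = length Cs"
    using p by (rule list_all2_lengthD)
  have q: "cone M [Cs ! j] (pss ! j) (Ass ! j)" if "j < length Cs" for j
    using universal_product_proj[OF Cs[OF that]] by blast
  \<comment> \<open>By associativity, the components of \<open>t\<close> at the flat family are the
    components of its components.\<close>
  have comps: "map (?pr t) ?rss = map2 (\<lambda>qs s. ?pr s qs) pss (?pr t ps)"
    if t: "t \<in> hom M Xs C" for Xs t
  proof (rule nth_equalityI)
    fix j assume "j < length (map (?pr t) ?rss)"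
    then have j: "j < length Cs"
      using len lenp by simp
    have pj: "ps ! j \<in> hom M [C] (Cs ! j)"
      using p j by (simp add: list_all2_conv_all_nth)
    have "mcomp M (mcomp M r [ps ! j]) [t] = mcomp M r [mcomp M (ps ! j) [t]]"
      if r: "r \<in> set (pss ! j)" for r
    proof -
      obtain A where "r \<in> hom M [Cs ! j] A"
        using q[OF j] r by (auto simp: in_set_conv_nth list_all2_conv_all_nth)
      then show ?thesis
        using mcomp_unary_assoc[OF _ pj, of r _ "[t]"] homD[OF t] homD[OF pj]
        by (simp add: composable_def)
    qed
    then show "map (?pr t) ?rss ! j = map2 (\<lambda>qs s. ?pr s qs) pss (?pr t ps) ! j"
      using j len lenp by simp
  qed (use len lenp in simp)
  show ?thesis
  proof (rule universal_productI)
    show "C \<in> obj M"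
      using universal_product_proj[OF C] by blast
    show "cone M [C] (concat ?rss) (concat Ass)"
    proof (rule list_all2_concat)
      show "list_all2 (cone M [C]) ?rss Ass"
      proof (rule list_all2_all_nthI)
        fix j assume "j < length ?rss"
        then have j: "j < length Cs"
          using len lenp by simp
        then have "ps ! j \<in> hom M [C] (Cs ! j)"
          using p by (simp add: list_all2_conv_all_nth)
        then show "cone M [C] (?rss ! j) (Ass ! j)"
          using cone_mcomp[OF q[OF j]] j len lenp by simp
      qed (use len lenp in simp)
    qed
  next
    fix Xs fs
    assume Xs: "set Xs \<subseteq> obj M" and "cone M Xs fs (concat Ass)"
    from this(2) obtain fss where fs: "fs = concat fss" and fss: "list_all2 (cone M Xs) fss Ass"
      by (rule list_all2_concat_rightE)
    have "\<exists>s. s \<in> hom M Xs (Cs ! j) \<and> ?pr s (pss ! j) = fss ! j" if "j < length Cs" for j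
      using universal_product_exists[OF Cs[OF that] Xs, of "fss ! j"] fss that len
      by (metis list_all2_conv_all_nth)
    then obtain s where s: "\<And>j. j < length Cs \<Longrightarrow> s j \<in> hom M Xs (Cs ! j)"
      "\<And>j. j < length Cs \<Longrightarrow> ?pr (s j) (pss ! j) = fss ! j"
      by metis
    have "cone M Xs (map s [0..<length Cs]) Cs"
      using s(1) by (simp add: list_all2_conv_all_nth)
    then obtain t where t: "t \<in> hom M Xs C" "?pr t ps = map s [0..<length Cs]"
      by (rule universal_product_exists[OF C Xs])
    have "map (?pr t) ?rss = fss"
      unfolding comps[OF t(1)] t(2)
      by (rule nth_equalityI) (use s(2) len fss in \<open>auto simp: list_all2_conv_all_nth\<close>)
    then show "\<exists>t. t \<in> hom M Xs C \<and> ?pr t (concat ?rss) = fs"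
      using t(1) fs by (metis map_concat)
  next
    fix Xs t t'
    assume t: "t \<in> hom M Xs C" "t' \<in> hom M Xs C"
      and eq: "?pr t (concat ?rss) = ?pr t' (concat ?rss)"
    \<comment> \<open>A flattened equation can be cut again because corresponding blocks on the two
      sides have equal lengths.\<close>
    have "map (?pr t) ?rss = map (?pr t') ?rss"
      using eq unfolding map_concat
      by (rule concat_injective) (auto simp: zip_map_map set_zip)
    then have rss: "map2 (\<lambda>qs s. ?pr s qs) pss (?pr t ps) = map2 (\<lambda>qs s. ?pr s qs) pss (?pr t' ps)"
      using comps t by metis
    have "?pr t ps ! j = ?pr t' ps ! j" if j: "j < length Cs" for j
    proof (rule universal_product_ext[OF Cs[OF j]])
      have "ps ! j \<in> hom M [C] (Cs ! j)"
        using p j by (simp add: list_all2_conv_all_nth)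
      then show "?pr t ps ! j \<in> hom M Xs (Cs ! j)" "?pr t' ps ! j \<in> hom M Xs (Cs ! j)"
        using mcomp_unary_hom t j lenp by auto
      show "?pr (?pr t ps ! j) (pss ! j) = ?pr (?pr t' ps ! j) (pss ! j)"
        using arg_cong[OF rss, of "\<lambda>xs. xs ! j"] j len lenp by simp
    qed
    then have "?pr t ps = ?pr t' ps"
      using lenp by (simp add: list_eq_iff_nth_eq)
    then show "t = t'"
      by (rule universal_product_ext[OF C t])
  qed
qed

end


section \<open>Cartesian multicategories\<close>

locale cartesian_action = mapping_action M is_mapping act
  for M :: "('o, 'a, 'z) multicategory_scheme" and act
begin

section \<open>The action on hom-sets, and the variables\<close>

lemma act_in_hom:
  assumes "f \<in> hom M As B" "set Bs \<subseteq> obj M" "set \<sigma> \<subseteq> {..<length Bs}" "map ((!) Bs) \<sigma> = As"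
  shows "act \<sigma> Bs f \<in> hom M Bs B"
  using act_hom[of \<sigma> Bs f] assms by (simp add: acts_on_def is_mapping_def hom_def)

lemma act_ident: "f \<in> hom M As B \<Longrightarrow> act [0..<length As] As f = f"
  using act_id[of f] by (simp add: hom_def)

lemma act_comp:
  assumes "f \<in> hom M As B" "set Bs \<subseteq> obj M" "set \<sigma> \<subseteq> {..<length Bs}" "map ((!) Bs) \<sigma> = As"
    "set Cs \<subseteq> obj M" "set \<rho> \<subseteq> {..<length Cs}" "map ((!) Cs) \<rho> = Bs"
  shows "act \<rho> Cs (act \<sigma> Bs f) = act (map ((!) \<rho>) \<sigma>) Cs f"
  using act_act[of \<sigma> Bs f \<rho> Cs] act_in_hom[OF assms(1-4)] assms
  by (simp add: acts_on_def is_mapping_def hom_def)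

lemma mcomp_act_unary:
  assumes "g \<in> hom M [A] B" "f \<in> hom M As A"
    "set Bs \<subseteq> obj M" "set \<sigma> \<subseteq> {..<length Bs}" "map ((!) Bs) \<sigma> = As"
  shows "mcomp M g [act \<sigma> Bs f] = act \<sigma> Bs (mcomp M g [f])"
  using mcomp_act_right[of g "[f]" "[\<sigma>]" "[Bs]"] assms
  by (simp add: acts_on_def is_mapping_def composable_def hom_def juxtapose_singleton)

definition coord :: "'o list \<Rightarrow> nat \<Rightarrow> 'a" where
  "coord As i = act [i] As (ident M (As ! i))"

lemma coord_hom: "set As \<subseteq> obj M \<Longrightarrow> i < length As \<Longrightarrow> coord As i \<in> hom M As (As ! i)"
  unfolding coord_def by (rule act_in_hom[OF ident_hom]) auto

text \<open>Law (ii) for the one-entry mapping \<open>[i]\<close>: only argument \<open>i\<close> is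
  used, while the sources of the others remain as dummy places.\<close>

lemma mcomp_coord:
  assumes "i < length As" "set fs \<subseteq> arr M" "map (trg M) fs = As"
  shows "mcomp M (coord As i) fs =
    act (block (map (\<lambda>g. length (src M g)) fs) i) (concat (map (src M) fs)) (fs ! i)"
proof -
  have "set As \<subseteq> obj M"
    using assms(2,3) trg_obj by (auto simp: subset_iff)
  moreover from this have "As ! i \<in> obj M"
    using assms(1) by auto
  moreover have "trg M (fs ! i) = As ! i" "fs ! i \<in> arr M"
    using assms by auto
  moreover have "mcomp M (ident M (As ! i)) [fs ! i] = fs ! i"
    using ident_left[of "fs ! i"] calculation by simp
  ultimately show ?thesis
    using mcomp_act_left[of "[i]" As "ident M (As ! i)" fs] assms homD[OF ident_hom[of "As ! i"]]
    by (simp add: coord_def acts_on_def is_mapping_def block_mapping_singleton)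
qed

text \<open>Functoriality: \<open>[i]\<close> followed by \<open>\<sigma>\<close> is
  \<open>[\<sigma> ! i]\<close>, so the action renames variables.\<close>

lemma act_coord:
  assumes "set Bs \<subseteq> obj M" "set \<sigma> \<subseteq> {..<length Bs}" "i < length \<sigma>"
  shows "act \<sigma> Bs (coord (map ((!) Bs) \<sigma>) i) = coord Bs (\<sigma> ! i)"
proof -
  have "\<sigma> ! i < length Bs"
    using assms nth_mem by blast
  moreover have "set (map ((!) Bs) \<sigma>) \<subseteq> obj M"
    using assms(1,2) by (auto simp: subset_iff)
  moreover have "Bs ! (\<sigma> ! i) \<in> obj M"
    using assms calculation by auto
  ultimately show ?thesis
    unfolding coord_def using assms
    by (subst act_comp[OF ident_hom]) auto
qed

text \<open>
  With this composition of \<open>h\<close> with a family of arrows on a common source, a cartesian multicategory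
  becomes a many-sorted abstract clone whose variables are the \<open>coord As i\<close>.
\<close>

definition clone_comp :: "'a \<Rightarrow> 'o list \<Rightarrow> 'a list \<Rightarrow> 'a" where
  "clone_comp h Xs fs = act (concat (replicate (length fs) [0..<length Xs])) Xs (mcomp M h fs)"

lemma mcomp_cone_hom:
  assumes "h \<in> hom M As B" "cone M Xs fs As"
  shows "mcomp M h fs \<in> hom M (concat (replicate (length As) Xs)) B"
  using mcomp_hom[OF cone_composable[OF assms]] cone_src[OF assms(2)] homD[OF assms(1)] by simp

text \<open>For an empty family the contraction is the empty mapping into \<open>Xs\<close>, so a
  nullary \<open>h\<close> still acquires the source \<open>Xs\<close>; the nullary products need no
  separate treatment.\<close>

lemma clone_comp_hom:
  assumes "h \<in> hom M As B" "cone M Xs fs As" "set Xs \<subseteq> obj M"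
  shows "clone_comp h Xs fs \<in> hom M Xs B"
  unfolding clone_comp_def
  by (rule act_in_hom[OF mcomp_cone_hom[OF assms(1,2)]])
    (use assms(3) in \<open>auto simp: list_all2_lengthD[OF assms(2)] map_nth_concat_replicate\<close>)

text \<open>\<open>mcomp_coord\<close> leaves \<open>fs ! i\<close> acting along block
  \<open>i\<close>, and the contraction restricted to any block is the identity.\<close>

lemma clone_comp_coord:
  assumes "cone M Xs fs As" "set Xs \<subseteq> obj M" "i < length As"
  shows "clone_comp (coord As i) Xs fs = fs ! i"
proof -
  let ?n = "length As" and ?k = "length Xs"
  let ?D = "concat (replicate ?n [0..<?k])"
  have len: "length fs = ?n"
    using assms(1) by (rule list_all2_lengthD)
  have fi: "fs ! i \<in> hom M Xs (As ! i)"
    using assms by (simp add: list_all2_conv_all_nth)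
  have lens: "map (\<lambda>g. length (src M g)) fs = map length (replicate ?n Xs)"
    using arg_cong[OF cone_src[OF assms(1)], of "map length"] by (simp add: comp_def)
  have block: "map ((!) ?D) (block (map length (replicate ?n Xs)) i) = [0..<?k]"
    using map_nth_concat_block[of i "replicate ?n [0..<?k]"] assms(3) by simp
  have "clone_comp (coord As i) Xs fs =
      act ?D Xs (act (block (map length (replicate ?n Xs)) i) (concat (replicate ?n Xs)) (fs ! i))"
    using assms by (simp only: clone_comp_def mcomp_coord cone_arr cone_trg lens cone_src len)
  also have "\<dots> = act (map ((!) ?D) (block (map length (replicate ?n Xs)) i)) Xs (fs ! i)"
  proof (rule act_comp[OF fi])
    show "set (block (map length (replicate ?n Xs)) i) \<subseteq> {..<length (concat (replicate ?n Xs))}"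
      using assms(3) by (intro set_block_subset) simp
    show "map ((!) (concat (replicate ?n Xs))) (block (map length (replicate ?n Xs)) i) = Xs"
      using map_nth_concat_block[of i "replicate ?n Xs"] assms(3) by simp
    show "map ((!) Xs) ?D = concat (replicate ?n Xs)"
      by (rule map_nth_concat_replicate)
  qed (use assms(2) in auto)
  finally show ?thesis
    using block act_ident[OF fi] by simp
qed

text \<open>Each variable is \<open>[i]\<close> acting on an identity. Law (i) moves these actions
  outside \<open>h\<close>, where they send \<open>i\<close> to place \<open>i\<close> of the
  \<open>i\<close>-th copy of \<open>As\<close>; the contraction sends that place back to
  \<open>i\<close>.\<close>

lemma clone_comp_coords:
  assumes h: "h \<in> hom M As B"
  shows "clone_comp h As (map (coord As) [0..<length As]) = h"
proof -
  let ?n = "length As"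
  let ?D = "concat (replicate ?n [0..<?n])" and ?As = "concat (replicate ?n As)"
  let ?J = "juxtapose (replicate ?n ?n) (map (\<lambda>i. [i]) [0..<?n])"
  have As: "set As \<subseteq> obj M"
    using hom_obj[OF h] by blast
  have J: "?J = map (\<lambda>i. offset (map length (replicate ?n As)) i + i) [0..<?n]"
  proof -
    have "map (\<lambda>i. map ((+) (offset (replicate ?n ?n) i)) (map (\<lambda>i. [i]) [0..<?n] ! i)) [0..<?n] =
        map (\<lambda>i. [offset (replicate ?n ?n) i + i]) [0..<?n]"
      by (rule map_cong) simp_all
    then show ?thesis
      by (simp only: juxtapose_def length_map length_upt diff_zero concat_map_singleton map_replicate)
  qed
  have DJ: "map ((!) ?D) ?J = [0..<?n]"
  proof (rule nth_equalityI)
    fix i assume "i < length (map ((!) ?D) ?J)"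
    then have "i < ?n"
      by (simp add: J)
    then show "map ((!) ?D) ?J ! i = [0..<?n] ! i"
      using nth_concat_offset[of i "replicate ?n [0..<?n]" i] by (simp add: J)
  qed (simp add: J)
  have idents: "set (map (ident M) As) \<subseteq> arr M" "map (trg M) (map (ident M) As) = As"
    "concat (map (src M) (map (ident M) As)) = As"
    using As by (induction As) (auto dest: homD[OF ident_hom])
  have "mcomp M h (map (coord As) [0..<?n]) =
      mcomp M h (map (\<lambda>i. act (map (\<lambda>i. [i]) [0..<?n] ! i) (replicate ?n As ! i)
        (map (ident M) As ! i)) [0..<length (map (ident M) As)])"
    by (intro arg_cong[where f = "mcomp M h"]) (auto simp: coord_def)
  also have "\<dots> = act (juxtapose (map length (replicate ?n As)) (map (\<lambda>i. [i]) [0..<?n])) ?As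
      (mcomp M h (map (ident M) As))"
  proof (rule mcomp_act_right)
    show "composable M h (map (ident M) As)"
      using homD[OF h] idents by (simp add: composable_def)
    show "acts_on M is_mapping (map (\<lambda>i. [i]) [0..<?n] ! i) (replicate ?n As ! i)
        (map (ident M) As ! i)" if "i < length (map (ident M) As)" for i
    proof -
      have "As ! i \<in> obj M"
        using that As by auto
      then show ?thesis
        using that As homD[OF ident_hom[of "As ! i"]] by (simp add: acts_on_def is_mapping_def)
    qed
  qed simp_all
  also have "\<dots> = act ?J ?As h"
    using ident_right[of h] homD[OF h] by simp
  finally have "clone_comp h As (map (coord As) [0..<?n]) = act ?D As (act ?J ?As h)"
    by (simp add: clone_comp_def)
  also have "\<dots> = act (map ((!) ?D) ?J) As h"
  proof (rule act_comp[OF h])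
    show "set ?J \<subseteq> {..<length ?As}"
      using offset_length_concat_less[of _ "replicate ?n As"] by (fastforce simp: J)
    show "map ((!) ?As) ?J = As"
      by (rule nth_equalityI) (use nth_concat_offset[of _ "replicate ?n As"] in \<open>auto simp: J\<close>)
    show "map ((!) As) ?D = ?As"
      by (rule map_nth_concat_replicate)
  qed (use As in auto)
  finally show ?thesis
    using DJ act_ident[OF h] by simp
qed

text \<open>Law (i) with a single argument, where juxtaposition is trivial, lets a unary
  \<open>g\<close> pass the contraction.\<close>

lemma mcomp_clone_comp:
  assumes "g \<in> hom M [A] B" "h \<in> hom M As A" "cone M Xs fs As" "set Xs \<subseteq> obj M"
  shows "mcomp M g [clone_comp h Xs fs] = clone_comp (mcomp M g [h]) Xs fs"
proof -
  have "mcomp M g [clone_comp h Xs fs] =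
      act (concat (replicate (length fs) [0..<length Xs])) Xs (mcomp M g [mcomp M h fs])"
    unfolding clone_comp_def
    by (rule mcomp_act_unary[OF assms(1) mcomp_cone_hom[OF assms(2,3)] assms(4)])
      (auto simp: list_all2_lengthD[OF assms(3)] map_nth_concat_replicate)
  then show ?thesis
    using mcomp_unary_assoc[OF assms(1,2) cone_composable[OF assms(2,3)]]
    by (simp add: clone_comp_def)
qed

text \<open>Law (ii) moves the contraction past \<open>t\<close>: a copy of \<open>t\<close> enters
  every copy of \<open>C\<close>, and what is contracted afterwards are copies of \<open>Xs\<close>.
  Associativity then hands one copy of \<open>t\<close> to each entry of \<open>ps\<close>.\<close>

lemma clone_comp_mcomp:
  assumes h: "h \<in> hom M As B" and ps: "cone M [C] ps As" and t: "t \<in> hom M Xs C"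
  shows "mcomp M (clone_comp h [C] ps) [t] = clone_comp h Xs (map (\<lambda>p. mcomp M p [t]) ps)"
proof -
  let ?n = "length As"
  have len: "length ps = ?n"
    using ps by (rule list_all2_lengthD)
  have hps: "mcomp M h ps \<in> hom M (replicate ?n C) B"
    using mcomp_cone_hom[OF h ps] by (simp add: concat_replicate_single)
  have C: "C \<in> obj M"
    using hom_obj[OF t] by blast
  have zeros: "concat (replicate ?n [0..<length [C]]) = replicate ?n 0"
    by simp
  have "mcomp M (clone_comp h [C] ps) [t] = mcomp M (act (replicate ?n 0) [C] (mcomp M h ps)) [t]"
    by (simp only: clone_comp_def len zeros)
  also have "\<dots> = act (block_mapping (map (\<lambda>g. length (src M g)) [t]) (replicate ?n 0))
      (concat (map (src M) [t])) (mcomp M (mcomp M h ps) (map ((!) [t]) (replicate ?n 0)))"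
    by (rule mcomp_act_left)
      (use C homD[OF hps] homD[OF t] in \<open>auto simp: acts_on_def is_mapping_def\<close>)
  also have "\<dots> = act (concat (replicate ?n [0..<length Xs])) Xs
      (mcomp M (mcomp M h ps) (concat (replicate ?n [t])))"
    by (simp add: homD[OF t] block_mapping_replicate concat_replicate_single)
  also have "mcomp M (mcomp M h ps) (concat (replicate ?n [t])) =
      mcomp M h (map2 (mcomp M) ps (replicate ?n [t]))"
  proof (rule mcomp_assoc[symmetric, OF cone_composable[OF h ps]])
    fix i assume "i < length ps"
    then have "ps ! i \<in> hom M [C] (As ! i)"
      using ps by (simp add: list_all2_conv_all_nth)
    then show "composable M (ps ! i) (replicate ?n [t] ! i)"
      using \<open>i < length ps\<close> len by (simp add: composable_def homD[OF t] homD)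
  qed (simp add: len)
  also have "map2 (mcomp M) ps (replicate ?n [t]) = map (\<lambda>p. mcomp M p [t]) ps"
    by (rule nth_equalityI) (use len in auto)
  finally show ?thesis
    by (simp add: clone_comp_def len)
qed

end


section \<open>The multicategory of a category with finite products\<close>

lemma chomD:
  assumes "f \<in> chom C A B"
  shows "f \<in> carr C" "cdom C f = A" "ccod C f = B"
  using assms by (simp_all add: chom_def)

lemma (in category) chom_obj:
  assumes "f \<in> chom C A B"
  shows "A \<in> cobj C" "B \<in> cobj C"
  using assms cdom_obj[of f] ccod_obj[of f] by (simp_all add: chom_def)

section \<open>Chosen products, tuples and reindexing\<close>

context fp_category
begin

lemma product_obj: "set As \<subseteq> cobj C \<Longrightarrow> product C As \<in> cobj C"
  using product[of As] by (simp add: is_product_def)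

lemma length_projections: "set As \<subseteq> cobj C \<Longrightarrow> length (projections C As) = length As"
  using product[of As] by (simp add: is_product_def)

lemma projections_hom:
  "set As \<subseteq> cobj C \<Longrightarrow> i < length As \<Longrightarrow> projections C As ! i \<in> chom C (product C As) (As ! i)"
  using product[of As] by (simp add: is_product_def)

lemma ex1_tuple:
  assumes "set As \<subseteq> cobj C" "X \<in> cobj C" "length fs = length As"
    "\<And>i. i < length As \<Longrightarrow> fs ! i \<in> chom C X (As ! i)"
  shows "\<exists>!t. t \<in> chom C X (product C As) \<and>
    (\<forall>i < length As. ccomp C (projections C As ! i) t = fs ! i)"
  using product[OF assms(1)] assms(2-) by (simp add: is_product_def)

text \<open>The projections are jointly monic; the equations between arrows into chosen products
  below are reduced to components by this.\<close>

lemma product_ext: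
  assumes "set As \<subseteq> cobj C" "t \<in> chom C X (product C As)" "t' \<in> chom C X (product C As)"
    and eq: "\<And>i. i < length As \<Longrightarrow>
      ccomp C (projections C As ! i) t = ccomp C (projections C As ! i) t'"
  shows "t = t'"
proof -
  let ?fs = "map (\<lambda>p. ccomp C p t) (projections C As)"
  have "\<exists>!t. t \<in> chom C X (product C As) \<and>
    (\<forall>i < length As. ccomp C (projections C As ! i) t = ?fs ! i)"
    using assms chom_obj ccomp_hom[OF _ projections_hom]
    by (intro ex1_tuple) (auto simp: length_projections)
  then show ?thesis
    using assms by (auto simp: length_projections)
qed

lemma
  assumes "set As \<subseteq> cobj C" "X \<in> cobj C" "length fs = length As"
    "\<And>i. i < length As \<Longrightarrow> fs ! i \<in> chom C X (As ! i)"
  shows tuple_hom: "tuple C X As fs \<in> chom C X (product C As)"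
    and proj_tuple:
      "\<And>i. i < length As \<Longrightarrow> ccomp C (projections C As ! i) (tuple C X As fs) = fs ! i"
  using theI'[OF ex1_tuple[OF assms]] unfolding tuple_def by blast+

lemma
  assumes Bs: "set Bs \<subseteq> cobj C" and \<sigma>: "set \<sigma> \<subseteq> {..<length Bs}" and As: "map ((!) Bs) \<sigma> = As"
  shows reindexing_hom: "reindexing C \<sigma> Bs \<in> chom C (product C Bs) (product C As)"
    and proj_reindexing: "\<And>i. i < length As \<Longrightarrow>
      ccomp C (projections C As ! i) (reindexing C \<sigma> Bs) = projections C Bs ! (\<sigma> ! i)"
proof -
  have "\<sigma> ! i < length Bs" if "i < length \<sigma>" for i
    using \<sigma> that nth_mem by blast
  then have comps: "map ((!) (projections C Bs)) \<sigma> ! i \<in> chom C (product C Bs) (As ! i)"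
    if "i < length As" for i
    using that projections_hom[OF Bs] As by auto
  have "set As \<subseteq> cobj C"
    using Bs \<sigma> As by (auto simp: subset_iff)
  moreover have "length (map ((!) (projections C Bs)) \<sigma>) = length As"
    using As by auto
  ultimately show "reindexing C \<sigma> Bs \<in> chom C (product C Bs) (product C As)"
    "\<And>i. i < length As \<Longrightarrow>
      ccomp C (projections C As ! i) (reindexing C \<sigma> Bs) = projections C Bs ! (\<sigma> ! i)"
    using tuple_hom[OF _ product_obj[OF Bs] _ comps] proj_tuple[OF _ product_obj[OF Bs] _ comps] As
    by (auto simp: reindexing_def)
qed

lemma reindexing_id:
  assumes "set Bs \<subseteq> cobj C"
  shows "reindexing C [0..<length Bs] Bs = cident C (product C Bs)"
proof (rule product_ext[OF assms])
  have \<sigma>: "set [0..<length Bs] \<subseteq> {..<length Bs}"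
    by auto
  show "reindexing C [0..<length Bs] Bs \<in> chom C (product C Bs) (product C Bs)"
    by (rule reindexing_hom[OF assms \<sigma>]) (simp add: map_nth)
  show "cident C (product C Bs) \<in> chom C (product C Bs) (product C Bs)"
    by (rule cident_hom[OF product_obj[OF assms]])
  show "ccomp C (projections C Bs ! i) (reindexing C [0..<length Bs] Bs) =
      ccomp C (projections C Bs ! i) (cident C (product C Bs))" if "i < length Bs" for i
    using proj_reindexing[OF assms \<sigma> map_nth that] cident_right[OF projections_hom[OF assms that]]
      that by simp
qed

text \<open>Both sides select the projection number \<open>\<rho> ! (\<sigma> ! i)\<close>. The
  order is reversed: \<open>\<sigma>\<close> comes first on indices, and its reindexing comes
  last.\<close>

lemma reindexing_comp:
  assumes Bs: "set Bs \<subseteq> cobj C" and \<sigma>: "set \<sigma> \<subseteq> {..<length Bs}"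
    and Cs: "set Cs \<subseteq> cobj C" and \<rho>: "set \<rho> \<subseteq> {..<length Cs}" "map ((!) Cs) \<rho> = Bs"
  shows "ccomp C (reindexing C \<sigma> Bs) (reindexing C \<rho> Cs) = reindexing C (map ((!) \<rho>) \<sigma>) Cs"
proof (rule product_ext)
  let ?As = "map ((!) Bs) \<sigma>"
  have len: "length \<rho> = length Bs"
    using \<rho>(2) by auto
  show As: "set ?As \<subseteq> cobj C"
    using Bs \<sigma> by (auto simp: subset_iff)
  have "\<rho> ! x < length Cs \<and> Cs ! (\<rho> ! x) = Bs ! x" if "x \<in> set \<sigma>" for x
    using subsetD[OF \<sigma> that] subsetD[OF \<rho>(1) nth_mem[of x \<rho>]] len arg_cong[OF \<rho>(2), of "\<lambda>xs. xs ! x"]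
    by simp
  then have \<rho>\<sigma>: "set (map ((!) \<rho>) \<sigma>) \<subseteq> {..<length Cs}"
    and As_eq: "map ((!) Cs) (map ((!) \<rho>) \<sigma>) = ?As"
    by auto
  have r\<sigma>: "reindexing C \<sigma> Bs \<in> chom C (product C Bs) (product C ?As)"
    by (rule reindexing_hom[OF Bs \<sigma> refl])
  have r\<rho>: "reindexing C \<rho> Cs \<in> chom C (product C Cs) (product C Bs)"
    by (rule reindexing_hom[OF Cs \<rho>])
  show "ccomp C (reindexing C \<sigma> Bs) (reindexing C \<rho> Cs) \<in> chom C (product C Cs) (product C ?As)"
    by (rule ccomp_hom[OF r\<rho> r\<sigma>])
  show "reindexing C (map ((!) \<rho>) \<sigma>) Cs \<in> chom C (product C Cs) (product C ?As)"
    by (rule reindexing_hom[OF Cs \<rho>\<sigma> As_eq])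
  fix i assume i: "i < length ?As"
  then have \<sigma>i: "\<sigma> ! i < length Bs"
    using \<sigma> nth_mem by fastforce
  have "ccomp C (projections C ?As ! i) (ccomp C (reindexing C \<sigma> Bs) (reindexing C \<rho> Cs)) =
      ccomp C (projections C Bs ! (\<sigma> ! i)) (reindexing C \<rho> Cs)"
    using ccomp_assoc[OF r\<rho> r\<sigma> projections_hom[OF As i]] proj_reindexing[OF Bs \<sigma> refl i] by simp
  also have "\<dots> = projections C Cs ! (\<rho> ! (\<sigma> ! i))"
    by (rule proj_reindexing[OF Cs \<rho> \<sigma>i])
  also have "\<dots> = ccomp C (projections C ?As ! i) (reindexing C (map ((!) \<rho>) \<sigma>) Cs)"
    using proj_reindexing[OF Cs \<rho>\<sigma> As_eq i] i by simp
  finally show "ccomp C (projections C ?As ! i)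
      (ccomp C (reindexing C \<sigma> Bs) (reindexing C \<rho> Cs)) =
      ccomp C (projections C ?As ! i) (reindexing C (map ((!) \<rho>) \<sigma>) Cs)" .
qed

section \<open>Arrows, composition and action in the multicategory of \<open>C\<close>\<close>

abbreviation N where "N \<equiv> times_multicategory C"

lemma times_simps [simp]:
  "obj N = cobj C" "src N = fst" "trg N = (\<lambda>f. ccod C (snd f))"
  "ident N A = ([A], projections C [A] ! 0)"
  "mcomp N = times_comp C" "perm N \<sigma> Bs f = (Bs, ccomp C (snd f) (reindexing C \<sigma> Bs))"
  by (simp_all add: times_multicategory_def)

lemma arr_times: "f \<in> arr N \<longleftrightarrow>
    set (fst f) \<subseteq> cobj C \<and> snd f \<in> chom C (product C (fst f)) (ccod C (snd f))"
  by (cases f) (auto simp: times_multicategory_def chom_def)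

lemma snd_hom_times: "f \<in> arr N \<Longrightarrow> snd f \<in> chom C (product C (fst f)) (ccod C (snd f))"
  by (simp add: arr_times)

lemma hom_times: "f \<in> hom N As B \<longleftrightarrow>
    fst f = As \<and> set As \<subseteq> cobj C \<and> snd f \<in> chom C (product C As) B"
  by (auto simp: hom_def arr_times chom_def)

text \<open>The product of the arrows \<open>fs\<close>, precomposed with the regrouping of the concatenated product.\<close>

definition parallel :: "'o list \<Rightarrow> ('o list \<times> 'a) list \<Rightarrow> 'a" where
  "parallel As fs =
     (let Xs = concat (map fst fs); ms = map (\<lambda>f. length (fst f)) fs in
      tuple C (product C Xs) As
        (map (\<lambda>j. ccomp C (snd (fs ! j)) (reindexing C (block ms j) Xs)) [0..<length fs]))"

lemma times_comp_eq:
  "times_comp C g fs = (concat (map fst fs), ccomp C (snd g) (parallel (fst g) fs))"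
  by (simp add: times_comp_def parallel_def Let_def)

lemma block_fst:
  assumes "j < length fs"
  shows "set (block (map (\<lambda>f. length (fst f)) fs) j) \<subseteq> {..<length (concat (map fst fs))}"
    "map ((!) (concat (map fst fs))) (block (map (\<lambda>f. length (fst f)) fs) j) = fst (fs ! j)"
  using set_block_subset[of j "map fst fs"] map_nth_concat_block[of j "map fst fs"] assms
  by (simp_all add: comp_def)

lemma block_mapping_fst:
  assumes "\<And>s. s \<in> set \<sigma> \<Longrightarrow> s < length fs"
  shows "set (block_mapping (map (\<lambda>f. length (fst f)) fs) \<sigma>) \<subseteq> {..<length (concat (map fst fs))}"
    "map ((!) (concat (map fst fs))) (block_mapping (map (\<lambda>f. length (fst f)) fs) \<sigma>) =
      concat (map fst (map ((!) fs) \<sigma>))"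
proof -
  have "map ((!) (map fst fs)) \<sigma> = map fst (map ((!) fs) \<sigma>)"
    using assms by simp
  then show "set (block_mapping (map (\<lambda>f. length (fst f)) fs) \<sigma>) \<subseteq> {..<length (concat (map fst fs))}"
    "map ((!) (concat (map fst fs))) (block_mapping (map (\<lambda>f. length (fst f)) fs) \<sigma>) =
      concat (map fst (map ((!) fs) \<sigma>))"
    using set_block_mapping_subset[of \<sigma> "map fst fs"] map_nth_block_mapping[of \<sigma> "map fst fs"] assms
    by (simp_all only: map_map comp_def length_map)
qed

lemma concat_fst_obj:
  assumes "set fs \<subseteq> arr N"
  shows "set (concat (map fst fs)) \<subseteq> cobj C"
  using assms by (auto simp: arr_times subset_iff)

lemma reindexing_block_hom:
  assumes "set fs \<subseteq> arr N" "j < length fs"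
  shows "reindexing C (block (map (\<lambda>f. length (fst f)) fs) j) (concat (map fst fs))
    \<in> chom C (product C (concat (map fst fs))) (product C (fst (fs ! j)))"
  by (rule reindexing_hom[OF concat_fst_obj[OF assms(1)] block_fst[OF assms(2)]])

lemma
  assumes fs: "set fs \<subseteq> arr N" and As: "map (trg N) fs = As"
  shows parallel_hom:
      "parallel As fs \<in> chom C (product C (concat (map fst fs))) (product C As)"
    and proj_parallel: "\<And>j. j < length fs \<Longrightarrow>
      ccomp C (projections C As ! j) (parallel As fs) =
      ccomp C (snd (fs ! j))
        (reindexing C (block (map (\<lambda>f. length (fst f)) fs) j) (concat (map fst fs)))"
proof -
  let ?cs = "map (\<lambda>j. ccomp C (snd (fs ! j))
      (reindexing C (block (map (\<lambda>f. length (fst f)) fs) j) (concat (map fst fs)))) [0..<length fs]"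
  have len: "length ?cs = length As"
    using As by auto
  have "snd (fs ! j) \<in> chom C (product C (fst (fs ! j))) (As ! j)" if "j < length fs" for j
    using snd_hom_times[OF subsetD[OF fs nth_mem[OF that]]] that As by auto
  then have comps: "?cs ! j \<in> chom C (product C (concat (map fst fs))) (As ! j)"
    if "j < length As" for j
    using ccomp_hom[OF reindexing_block_hom[OF fs]] that As by auto
  have As': "set As \<subseteq> cobj C"
    using fs As chom_obj by (fastforce simp: arr_times)
  note * = As' product_obj[OF concat_fst_obj[OF fs]] len comps
  have par: "parallel As fs = tuple C (product C (concat (map fst fs))) As ?cs"
    by (simp add: parallel_def Let_def)
  show "parallel As fs \<in> chom C (product C (concat (map fst fs))) (product C As)"
    unfolding par by (rule tuple_hom[OF *])
  show "ccomp C (projections C As ! j) (parallel As fs) = ccomp C (snd (fs ! j))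
        (reindexing C (block (map (\<lambda>f. length (fst f)) fs) j) (concat (map fst fs)))"
    if "j < length fs" for j
    unfolding par using proj_tuple[OF *, of j] that len by simp
qed

lemma composable_times:
  assumes "composable N g fs"
  shows "set (fst g) \<subseteq> cobj C" "snd g \<in> chom C (product C (fst g)) (ccod C (snd g))"
    "set fs \<subseteq> arr N" "map (trg N) fs = fst g"
  using assms by (simp_all add: composable_def arr_times del: times_simps(3))

lemma times_comp_hom:
  assumes "composable N g fs"
  shows "times_comp C g fs \<in> hom N (concat (map fst fs)) (ccod C (snd g))"
  using concat_fst_obj ccomp_hom[OF parallel_hom] composable_times[OF assms]
  by (simp add: hom_times times_comp_eq)

text \<open>Associativity of \<open>times_comp\<close> without the outer arrow. Components are
  compared at two levels, over \<open>As\<close> and, in \<open>block_comp\<close>, over the source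
  of each \<open>fs ! j\<close>, since each composite contains a parallel arrow of its own.\<close>

lemma parallel_comp:
  assumes fs: "set fs \<subseteq> arr N" and As: "map (trg N) fs = As"
    and len: "length gss = length fs"
    and gss: "\<And>j. j < length fs \<Longrightarrow> composable N (fs ! j) (gss ! j)"
  shows "parallel As (map2 (times_comp C) fs gss) =
    ccomp C (parallel As fs) (parallel (concat (map fst fs)) (concat gss))"
    (is "parallel As ?hs = ccomp C _ (parallel ?Ys ?gs)")
proof -
  let ?lens = "map (\<lambda>f. length (fst f))"
  let ?Zs = "concat (map fst ?gs)"
  have gs_arr: "set ?gs \<subseteq> arr N"
    by (rule composable_concat(1)[OF len gss])
  have gs_trg: "map (trg N) ?gs = ?Ys"
    using composable_concat(2)[OF len gss] by simp
  have hs_arr: "?hs ! j \<in> arr N" "trg N (?hs ! j) = trg N (fs ! j)" if "j < length fs" for j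
    using times_comp_hom[OF gss[OF that]] that len by (auto dest: homD)
  have hs: "set ?hs \<subseteq> arr N" "map (trg N) ?hs = As"
    using hs_arr len As by (auto simp: set_conv_nth list_eq_iff_nth_eq simp del: times_simps)
  have hs_fst: "map fst ?hs = map (\<lambda>gs. concat (map fst gs)) gss"
    using len by (simp add: list_eq_iff_nth_eq times_comp_eq)
  have hs_src: "concat (map fst ?hs) = ?Zs"
    unfolding hs_fst by (induction gss) auto
  have lens_gss: "map length gss = ?lens fs"
    using len gss by (simp add: list_eq_iff_nth_eq composable_def)
  have lens_gs: "?lens ?gs = concat (map ?lens gss)"
    by (simp add: map_concat)
  have "?lens ?hs = map length (map fst ?hs)"
    by simp
  then have lens_hs: "?lens ?hs = map sum_list (map ?lens gss)"
    unfolding hs_fst by (simp add: length_concat comp_def)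
  have par_gs: "parallel ?Ys ?gs \<in> chom C (product C ?Zs) (product C ?Ys)"
    by (rule parallel_hom[OF gs_arr gs_trg])
  have par_fs: "parallel As fs \<in> chom C (product C ?Ys) (product C As)"
    by (rule parallel_hom[OF fs As])
  have par_j: "parallel (fst (fs ! j)) (gss ! j) \<in>
      chom C (product C (concat (map fst (gss ! j)))) (product C (fst (fs ! j)))"
    if "j < length fs" for j
    using parallel_hom composable_times(3,4)[OF gss[OF that]] by blast
  have R_j: "reindexing C (block (?lens ?hs) j) ?Zs \<in>
      chom C (product C ?Zs) (product C (concat (map fst (gss ! j))))" if "j < length fs" for j
    using reindexing_block_hom[OF hs(1), of j] that len unfolding hs_src
    by (simp add: times_comp_eq)
  \<comment> \<open>Naturality of the projection onto block \<open>j\<close>: the part of the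
    flattened family that feeds \<open>fs ! j\<close> is \<open>gss ! j\<close>, applied to the
    corresponding part of the source.\<close>
  have block_comp: "ccomp C (reindexing C (block (?lens fs) j) ?Ys) (parallel ?Ys ?gs) =
      ccomp C (parallel (fst (fs ! j)) (gss ! j)) (reindexing C (block (?lens ?hs) j) ?Zs)"
    if j: "j < length fs" for j
  proof (rule product_ext)
    let ?B = "fst (fs ! j)" and ?gsj = "gss ! j"
    let ?r = "reindexing C (block (?lens fs) j) ?Ys"
    note gsj = composable_times[OF gss[OF j]]
    show "set ?B \<subseteq> cobj C"
      by (rule gsj)
    have r: "?r \<in> chom C (product C ?Ys) (product C ?B)"
      by (rule reindexing_block_hom[OF fs j])
    show "ccomp C ?r (parallel ?Ys ?gs) \<in> chom C (product C ?Zs) (product C ?B)"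
      by (rule ccomp_hom[OF par_gs r])
    show "ccomp C (parallel ?B ?gsj) (reindexing C (block (?lens ?hs) j) ?Zs) \<in>
        chom C (product C ?Zs) (product C ?B)"
      by (rule ccomp_hom[OF R_j[OF j] par_j[OF j]])
    fix k assume k: "k < length ?B"
    have lenj: "length ?gsj = length ?B"
      using gsj(4) by (metis length_map)
    let ?i = "offset (?lens fs) j + k"
    have i: "?i < length ?gs" "?gs ! ?i = ?gsj ! k"
      using offset_length_concat_less[of j gss k] nth_concat_offset[of j gss k] j k lenj len
      by (simp_all add: lens_gss)
    have gjk: "snd (?gsj ! k) \<in> chom C (product C (fst (?gsj ! k))) (?B ! k)"
    proof -
      have "?gsj ! k \<in> arr N"
        using gsj(3) k lenj by auto
      moreover have "ccod C (snd (?gsj ! k)) = ?B ! k"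
        using arg_cong[OF gsj(4), of "\<lambda>xs. xs ! k"] k lenj by simp
      ultimately show ?thesis
        using snd_hom_times by metis
    qed
    have "ccomp C (projections C ?B ! k) (ccomp C ?r (parallel ?Ys ?gs)) =
        ccomp C (projections C ?Ys ! ?i) (parallel ?Ys ?gs)"
      using ccomp_assoc[OF par_gs r projections_hom[OF gsj(1) k]]
        proj_reindexing[OF concat_fst_obj[OF fs] block_fst[OF j] k] j k by simp
    also have "\<dots> = ccomp C (snd (?gsj ! k)) (reindexing C (block (?lens ?gs) ?i) ?Zs)"
      using proj_parallel[OF gs_arr gs_trg i(1)] i(2) by simp
    \<comment> \<open>\<open>block_concat\<close> resolves the flat position of
      \<open>?gsj ! k\<close> into the group belonging to \<open>fs ! j\<close> and the place inside
      that group.\<close>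
    also have "block (?lens ?gs) ?i =
        map ((!) (block (?lens ?hs) j)) (block (?lens ?gsj) k)"
      using block_concat[of j "map ?lens gss" k] j k len lenj lens_gss lens_gs lens_hs
      by (simp add: comp_def)
    also have "reindexing C \<dots> ?Zs =
        ccomp C (reindexing C (block (?lens ?gsj) k) (concat (map fst ?gsj)))
          (reindexing C (block (?lens ?hs) j) ?Zs)"
    proof (rule reindexing_comp[symmetric])
      show "set (concat (map fst ?gsj)) \<subseteq> cobj C" "set ?Zs \<subseteq> cobj C"
        using concat_fst_obj[OF gsj(3)] concat_fst_obj[OF gs_arr] by blast+
      show "set (block (?lens ?gsj) k) \<subseteq> {..<length (concat (map fst ?gsj))}"
        using block_fst(1)[of k ?gsj] k lenj by simp
      show "set (block (?lens ?hs) j) \<subseteq> {..<length ?Zs}"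
        "map ((!) ?Zs) (block (?lens ?hs) j) = concat (map fst ?gsj)"
        using block_fst[of j ?hs] j len unfolding hs_src by (simp_all add: times_comp_eq)
    qed
    also have "ccomp C (snd (?gsj ! k)) \<dots> =
        ccomp C (ccomp C (snd (?gsj ! k))
          (reindexing C (block (?lens ?gsj) k) (concat (map fst ?gsj))))
          (reindexing C (block (?lens ?hs) j) ?Zs)"
      using ccomp_assoc[OF R_j[OF j] reindexing_block_hom[OF gsj(3)] gjk] k lenj by simp
    also have "\<dots> = ccomp C (ccomp C (projections C ?B ! k) (parallel ?B ?gsj))
          (reindexing C (block (?lens ?hs) j) ?Zs)"
      using proj_parallel[OF gsj(3,4), of k] k lenj by simp
    also have "\<dots> = ccomp C (projections C ?B ! k)
        (ccomp C (parallel ?B ?gsj) (reindexing C (block (?lens ?hs) j) ?Zs))"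
      by (rule ccomp_assoc[OF R_j[OF j] par_j[OF j] projections_hom[OF gsj(1) k], symmetric])
    finally show "ccomp C (projections C ?B ! k) (ccomp C ?r (parallel ?Ys ?gs)) =
      ccomp C (projections C ?B ! k)
        (ccomp C (parallel ?B ?gsj) (reindexing C (block (?lens ?hs) j) ?Zs))" .
  qed
  have As_obj: "set As \<subseteq> cobj C"
    using fs As chom_obj by (fastforce simp: arr_times)
  show ?thesis
  proof (rule product_ext[OF As_obj])
    show "parallel As ?hs \<in> chom C (product C ?Zs) (product C As)"
      using parallel_hom[OF hs] unfolding hs_src .
    show "ccomp C (parallel As fs) (parallel ?Ys ?gs) \<in> chom C (product C ?Zs) (product C As)"
      by (rule ccomp_hom[OF par_gs par_fs])
    fix j assume j': "j < length As"
    then have j: "j < length fs"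
      using As by auto
    have fj: "snd (fs ! j) \<in> chom C (product C (fst (fs ! j))) (ccod C (snd (fs ! j)))"
      using fs j by (intro snd_hom_times) auto
    have "ccomp C (projections C As ! j) (parallel As ?hs) =
        ccomp C (ccomp C (snd (fs ! j)) (parallel (fst (fs ! j)) (gss ! j)))
          (reindexing C (block (?lens ?hs) j) ?Zs)"
      using proj_parallel[OF hs, of j] j len unfolding hs_src by (simp add: times_comp_eq)
    also have "\<dots> = ccomp C (snd (fs ! j))
        (ccomp C (reindexing C (block (?lens fs) j) ?Ys) (parallel ?Ys ?gs))"
      using ccomp_assoc[OF R_j[OF j] par_j[OF j] fj] block_comp[OF j] by simp
    also have "\<dots> = ccomp C (ccomp C (projections C As ! j) (parallel As fs)) (parallel ?Ys ?gs)"
      using ccomp_assoc[OF par_gs reindexing_block_hom[OF fs j] fj] proj_parallel[OF fs As j]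
      by simp
    also have "\<dots> = ccomp C (projections C As ! j) (ccomp C (parallel As fs) (parallel ?Ys ?gs))"
      by (rule ccomp_assoc[OF par_gs par_fs projections_hom[OF As_obj j'], symmetric])
    finally show "ccomp C (projections C As ! j) (parallel As ?hs) =
        ccomp C (projections C As ! j) (ccomp C (parallel As fs) (parallel ?Ys ?gs))" .
  qed
qed

text \<open>An arrow \<open>g\<close> of \<open>C\<close> enters \<open>N\<close> as a unary arrow
  through the projection from the product of \<open>[A]\<close>; composing in \<open>N\<close>
  cancels that projection. Both the left identity law and the universal products of \<open>N\<close>
  depend on this.\<close>

lemma times_comp_unary_ident:
  assumes f: "f \<in> arr N" and g: "g \<in> chom C (ccod C (snd f)) B"
  shows "times_comp C ([ccod C (snd f)], ccomp C g (projections C [ccod C (snd f)] ! 0)) [f] =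
    (fst f, ccomp C g (snd f))"
proof -
  let ?A = "ccod C (snd f)"
  have A: "set [?A] \<subseteq> cobj C"
    using chom_obj[OF g] by simp
  have p: "projections C [?A] ! 0 \<in> chom C (product C [?A]) ?A"
    using projections_hom[OF A, of 0] by simp
  have par: "parallel [?A] [f] \<in> chom C (product C (fst f)) (product C [?A])"
    using parallel_hom[of "[f]" "[?A]"] f by simp
  have "ccomp C (projections C [?A] ! 0) (parallel [?A] [f]) =
      ccomp C (snd f) (reindexing C [0..<length (fst f)] (fst f))"
    using proj_parallel[of "[f]" "[?A]" 0] f by simp
  also have "\<dots> = snd f"
    using reindexing_id[of "fst f"] f cident_right by (auto simp: arr_times)
  finally show ?thesis
    using ccomp_assoc[OF par p g] by (simp add: times_comp_eq)
qed

lemma multicategory_times: "multicategory N"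
proof
  show "set (src N f) \<subseteq> obj N" "trg N f \<in> obj N" if "f \<in> arr N" for f
    using that chom_obj by (auto simp: arr_times)
  show ident: "ident N A \<in> hom N [A] A" if "A \<in> obj N" for A
    using that projections_hom[of "[A]" 0] by (simp add: hom_times)
  show "mcomp N f fs \<in> hom N (concat (map (src N) fs)) (trg N f)" if "composable N f fs" for f fs
    using times_comp_hom[OF that] by (simp add: comp_def cong: map_cong)
  show "mcomp N (ident N (trg N f)) [f] = f" if f: "f \<in> arr N" for f
  proof -
    have A: "ccod C (snd f) \<in> cobj C"
      using chom_obj[OF snd_hom_times[OF f]] by simp
    have "projections C [ccod C (snd f)] ! 0 \<in>
        chom C (product C [ccod C (snd f)]) (ccod C (snd f))"
      using projections_hom[of "[ccod C (snd f)]" 0] A by simp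
    then show ?thesis
      using times_comp_unary_ident[OF f cident_hom[OF A]] cident_left snd_hom_times[OF f] by simp
  qed
  show "mcomp N f (map (ident N) (src N f)) = f" if f: "f \<in> arr N" for f
  proof -
    let ?As = "fst f" and ?ids = "map (ident N) (fst f)"
    have As: "set ?As \<subseteq> cobj C"
      using f by (simp add: arr_times)
    have "ident N A \<in> arr N \<and> trg N (ident N A) = A" if "A \<in> set ?As" for A
      using homD(1,3)[OF ident, of A] that As by (auto simp: subset_iff)
    then have idents: "set ?ids \<subseteq> arr N" "map (trg N) ?ids = ?As"
      by (auto simp: map_idI simp del: times_simps)
    have conc: "concat (map fst ?ids) = ?As"
      by (simp add: comp_def)
    have "parallel ?As ?ids = cident C (product C ?As)"
    proof (rule product_ext[OF As])
      show "parallel ?As ?ids \<in> chom C (product C ?As) (product C ?As)"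
        using parallel_hom[OF idents] conc by simp
      show "cident C (product C ?As) \<in> chom C (product C ?As) (product C ?As)"
        by (rule cident_hom[OF product_obj[OF As]])
      fix j assume j: "j < length ?As"
      let ?b = "block (map (\<lambda>f. length (fst f)) ?ids) j"
      \<comment> \<open>Sources of identities have length one, so block \<open>j\<close> consists of
        position \<open>j\<close> alone.\<close>
      have "?b ! 0 = j"
        using j by (simp add: comp_def offset_def map_replicate_const sum_list_replicate)
      moreover have "set ?b \<subseteq> {..<length ?As}" "map ((!) ?As) ?b = [?As ! j]"
        using block_fst[of j ?ids] j conc by simp_all
      note proj_reindexing[OF As this, of 0]
      ultimately have "ccomp C (projections C ?As ! j) (parallel ?As ?ids) = projections C ?As ! j"
        using proj_parallel[OF idents, of j] j conc by simp
      then show "ccomp C (projections C ?As ! j) (parallel ?As ?ids) =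
          ccomp C (projections C ?As ! j) (cident C (product C ?As))"
        using cident_right[OF projections_hom[OF As j]] by simp
    qed
    then show ?thesis
      using cident_right[OF snd_hom_times[OF f]] conc by (simp add: times_comp_eq)
  qed
  show "mcomp N f (map2 (mcomp N) fs gss) = mcomp N (mcomp N f fs) (concat gss)"
    if f: "composable N f fs" and len: "length gss = length fs"
      and gss: "\<And>i. i < length fs \<Longrightarrow> composable N (fs ! i) (gss ! i)" for f fs gss
  proof -
    note f' = composable_times[OF f]
    have gss_arr: "set (concat gss) \<subseteq> arr N"
      by (rule composable_concat(1)[OF len gss])
    have gss_trg: "map (trg N) (concat gss) = concat (map fst fs)"
      using composable_concat(2)[OF len gss] by simp
    have src: "concat (map fst (map2 (times_comp C) fs gss)) = concat (map fst (concat gss))"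
    proof -
      have "map fst (map2 (times_comp C) fs gss) = map (\<lambda>gs. concat (map fst gs)) gss"
        using len by (simp add: list_eq_iff_nth_eq times_comp_eq)
      then show ?thesis
        using concat_concat[of "map (map fst) gss"] by (simp only: map_concat map_map comp_def)
    qed
    then show ?thesis
      using parallel_comp[OF f'(3,4) len gss]
        ccomp_assoc[OF parallel_hom[OF gss_arr gss_trg] parallel_hom[OF f'(3,4)] f'(2)]
      by (simp add: times_comp_eq)
  qed
qed

lemma acts_on_times:
  assumes "acts_on N is_mapping \<sigma> Bs f"
  shows "set Bs \<subseteq> cobj C" "set \<sigma> \<subseteq> {..<length Bs}" "map ((!) Bs) \<sigma> = fst f" "f \<in> arr N"
  using assms by (simp_all add: acts_on_def is_mapping_def)

text \<open>Law (i) without the outer arrow. On both sides component \<open>j\<close> is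
  \<open>snd (fs ! j)\<close> after a single reindexing, along \<open>\<sigma>s ! j\<close> placed
  inside block \<open>j\<close> of \<open>concat Bss\<close>.\<close>

lemma parallel_act_right:
  assumes fs: "set fs \<subseteq> arr N" and As: "map (trg N) fs = As"
    and len: "length \<sigma>s = length fs" "length Bss = length fs"
    and act: "\<And>i. i < length fs \<Longrightarrow> acts_on N is_mapping (\<sigma>s ! i) (Bss ! i) (fs ! i)"
  shows "parallel As (map (\<lambda>i. perm N (\<sigma>s ! i) (Bss ! i) (fs ! i)) [0..<length fs]) =
    ccomp C (parallel As fs) (reindexing C (juxtapose (map length Bss) \<sigma>s) (concat Bss))"
    (is "parallel As ?hs = ccomp C _ (reindexing C ?J _)")
proof -
  let ?lens = "map (\<lambda>f. length (fst f))"
  let ?Xs = "concat (map fst fs)"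
  have Bs: "set (Bss ! i) \<subseteq> cobj C" and \<sigma>: "set (\<sigma>s ! i) \<subseteq> {..<length (Bss ! i)}"
    and src: "map ((!) (Bss ! i)) (\<sigma>s ! i) = fst (fs ! i)"
    and snd: "snd (fs ! i) \<in> chom C (product C (fst (fs ! i))) (As ! i)"
    if "i < length fs" for i
    using act[OF that] snd_hom_times[of "fs ! i"] that As by (auto simp: acts_on_def is_mapping_def)
  have R: "reindexing C (\<sigma>s ! i) (Bss ! i) \<in>
      chom C (product C (Bss ! i)) (product C (fst (fs ! i)))" if "i < length fs" for i
    by (rule reindexing_hom[OF Bs[OF that] \<sigma>[OF that] src[OF that]])
  have h: "perm N (\<sigma>s ! i) (Bss ! i) (fs ! i) \<in> hom N (Bss ! i) (As ! i)" if "i < length fs" for i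
    using Bs[OF that] ccomp_hom[OF R[OF that] snd[OF that]] by (simp add: hom_times)
  have lenA: "length As = length fs"
    using As by auto
  have hs: "set ?hs \<subseteq> arr N" "map (trg N) ?hs = As"
    using homD(1,3)[OF h] lenA by (auto intro: nth_equalityI)
  have hs_fst: "map fst ?hs = Bss"
    by (rule nth_equalityI) (use len in simp_all)
  have lens_hs: "?lens ?hs = map length Bss"
    by (rule nth_equalityI) (use len in simp_all)
  have lens_\<sigma>s: "map length \<sigma>s = ?lens fs"
    by (rule nth_equalityI) (use len arg_cong[OF src, of _ length] in simp_all)
  have Bss: "set (concat Bss) \<subseteq> cobj C" and J: "set ?J \<subseteq> {..<length (concat Bss)}" and J_src: "map ((!) (concat Bss)) ?J = ?Xs"
    using acts_on_juxtapose[OF len act] by simp_all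
  have RJ: "reindexing C ?J (concat Bss) \<in> chom C (product C (concat Bss)) (product C ?Xs)"
    by (rule reindexing_hom[OF Bss J J_src])
  have par: "parallel As fs \<in> chom C (product C ?Xs) (product C As)"
    by (rule parallel_hom[OF fs As])
  have As_obj: "set As \<subseteq> cobj C"
    using fs As chom_obj by (fastforce simp: arr_times)
  show ?thesis
  proof (rule product_ext[OF As_obj])
    show "parallel As ?hs \<in> chom C (product C (concat Bss)) (product C As)"
      using parallel_hom[OF hs] unfolding hs_fst .
    show "ccomp C (parallel As fs) (reindexing C ?J (concat Bss)) \<in>
        chom C (product C (concat Bss)) (product C As)"
      by (rule ccomp_hom[OF RJ par])
    fix j assume j': "j < length As"
    then have j: "j < length fs"
      using As by auto
    have block: "set (block (map length Bss) j) \<subseteq> {..<length (concat Bss)}"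
      "map ((!) (concat Bss)) (block (map length Bss) j) = Bss ! j"
      using set_block_subset[of j Bss] map_nth_concat_block[of j Bss] j len by simp_all
    have RB: "reindexing C (block (map length Bss) j) (concat Bss) \<in>
        chom C (product C (concat Bss)) (product C (Bss ! j))"
      by (rule reindexing_hom[OF Bss block])
    \<comment> \<open>Entering block \<open>j\<close> shifts the values of
      \<open>\<sigma>s ! j\<close> by the offset, and so does juxtaposition on block
      \<open>j\<close> of its domain.\<close>
    have "map ((!) (block (map length Bss) j)) (\<sigma>s ! j) =
        map (\<lambda>k. offset (map length Bss) j + k) (\<sigma>s ! j)"
      using \<sigma>[OF j] j len by auto
    also have "\<dots> = map ((!) ?J) (block (?lens fs) j)"
      using map_nth_juxtapose_block[of j \<sigma>s "map length Bss"] j len lens_\<sigma>s by simp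
    finally have maps: "map ((!) (block (map length Bss) j)) (\<sigma>s ! j) =
        map ((!) ?J) (block (?lens fs) j)" .
    have "ccomp C (projections C As ! j) (parallel As ?hs) =
        ccomp C (ccomp C (snd (fs ! j)) (reindexing C (\<sigma>s ! j) (Bss ! j)))
          (reindexing C (block (map length Bss) j) (concat Bss))"
      using proj_parallel[OF hs, of j] j unfolding hs_fst lens_hs by simp
    also have "\<dots> = ccomp C (snd (fs ! j)) (reindexing C (map ((!) ?J) (block (?lens fs) j)) (concat Bss))"
      using ccomp_assoc[OF RB R[OF j] snd[OF j]] reindexing_comp[OF Bs[OF j] \<sigma>[OF j] Bss block] maps
      by simp
    also have "\<dots> = ccomp C (ccomp C (snd (fs ! j)) (reindexing C (block (?lens fs) j) ?Xs))
        (reindexing C ?J (concat Bss))"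
      using ccomp_assoc[OF RJ reindexing_block_hom[OF fs j] snd[OF j]]
        reindexing_comp[OF concat_fst_obj[OF fs] block_fst(1)[OF j] Bss J J_src] by simp
    also have "\<dots> = ccomp C (projections C As ! j)
        (ccomp C (parallel As fs) (reindexing C ?J (concat Bss)))"
      using ccomp_assoc[OF RJ par projections_hom[OF As_obj j']] proj_parallel[OF fs As j] by simp
    finally show "ccomp C (projections C As ! j) (parallel As ?hs) = ccomp C (projections C As ! j)
        (ccomp C (parallel As fs) (reindexing C ?J (concat Bss)))" .
  qed
qed

text \<open>Law (ii) without the outer arrow. On both sides component \<open>i\<close> is the arrow
  number \<open>\<sigma> ! i\<close> after the projection onto block \<open>\<sigma> ! i\<close> of
  the common source.\<close>

lemma reindexing_parallel:
  assumes fs: "set fs \<subseteq> arr N" and Bs: "map (trg N) fs = Bs"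
    and \<sigma>: "set \<sigma> \<subseteq> {..<length Bs}" and As: "map ((!) Bs) \<sigma> = As"
  shows "ccomp C (reindexing C \<sigma> Bs) (parallel Bs fs) =
    ccomp C (parallel As (map ((!) fs) \<sigma>))
      (reindexing C (block_mapping (map (\<lambda>f. length (fst f)) fs) \<sigma>) (concat (map fst fs)))"
    (is "_ = ccomp C (parallel As ?gs) (reindexing C ?bm ?Xs)")
proof -
  let ?lens = "map (\<lambda>f. length (fst f))"
  let ?Ys = "concat (map fst ?gs)"
  have lenB: "length Bs = length fs"
    using Bs by auto
  have \<sigma>s: "s < length fs" if "s \<in> set \<sigma>" for s
    using subsetD[OF \<sigma> that] lenB by simp
  have gs: "set ?gs \<subseteq> arr N" "map (trg N) ?gs = As"
    using fs \<sigma>s by (auto simp: Bs[symmetric] As[symmetric])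
  have lens_gs: "?lens ?gs = map length (map (block (?lens fs)) \<sigma>)"
    using \<sigma>s by simp
  have Xs: "set ?Xs \<subseteq> cobj C" and Ys: "set ?Ys \<subseteq> cobj C"
    using concat_fst_obj fs gs(1) by blast+
  have bm: "set ?bm \<subseteq> {..<length ?Xs}" and bm_src: "map ((!) ?Xs) ?bm = ?Ys"
    using block_mapping_fst \<sigma>s by blast+
  have Bs_obj: "set Bs \<subseteq> cobj C"
    using fs Bs chom_obj by (fastforce simp: arr_times)
  have As_obj: "set As \<subseteq> cobj C"
    using gs chom_obj by (fastforce simp: arr_times)
  have R: "reindexing C \<sigma> Bs \<in> chom C (product C Bs) (product C As)"
    by (rule reindexing_hom[OF Bs_obj \<sigma> As])
  have Rbm: "reindexing C ?bm ?Xs \<in> chom C (product C ?Xs) (product C ?Ys)"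
    by (rule reindexing_hom[OF Xs bm bm_src])
  have par_fs: "parallel Bs fs \<in> chom C (product C ?Xs) (product C Bs)"
    by (rule parallel_hom[OF fs Bs])
  have par_gs: "parallel As ?gs \<in> chom C (product C ?Ys) (product C As)"
    by (rule parallel_hom[OF gs])
  show ?thesis
  proof (rule product_ext[OF As_obj ccomp_hom[OF par_fs R] ccomp_hom[OF Rbm par_gs]])
    fix i assume i: "i < length As"
    then have i': "i < length \<sigma>" "i < length ?gs"
      using As by auto
    have \<sigma>i: "\<sigma> ! i < length fs"
      using \<sigma>s i' by simp
    have snd: "snd (?gs ! i) \<in> chom C (product C (fst (?gs ! i))) (As ! i)"
      using snd_hom_times[OF subsetD[OF gs(1) nth_mem[OF i'(2)]]] arg_cong[OF gs(2), of "\<lambda>xs. xs ! i"] i'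
      by simp
    have "ccomp C (projections C As ! i) (ccomp C (reindexing C \<sigma> Bs) (parallel Bs fs)) =
        ccomp C (projections C Bs ! (\<sigma> ! i)) (parallel Bs fs)"
      using ccomp_assoc[OF par_fs R projections_hom[OF As_obj i]]
        proj_reindexing[OF Bs_obj \<sigma> As i] by simp
    also have "\<dots> = ccomp C (snd (?gs ! i)) (reindexing C (block (?lens fs) (\<sigma> ! i)) ?Xs)"
      using proj_parallel[OF fs Bs \<sigma>i] i' by simp
    also have "block (?lens fs) (\<sigma> ! i) = map ((!) ?bm) (block (?lens ?gs) i)"
      using map_nth_concat_block[of i "map (block (?lens fs)) \<sigma>"] i' unfolding lens_gs
      by (simp add: block_mapping_def)
    also have "reindexing C \<dots> ?Xs = ccomp C (reindexing C (block (?lens ?gs) i) ?Ys) (reindexing C ?bm ?Xs)"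
      by (rule reindexing_comp[OF Ys block_fst(1)[OF i'(2)] Xs bm bm_src, symmetric])
    also have "ccomp C (snd (?gs ! i)) \<dots> =
        ccomp C (ccomp C (projections C As ! i) (parallel As ?gs)) (reindexing C ?bm ?Xs)"
      using ccomp_assoc[OF Rbm reindexing_block_hom[OF gs(1) i'(2)] snd] proj_parallel[OF gs i'(2)]
      by simp
    also have "\<dots> = ccomp C (projections C As ! i)
        (ccomp C (parallel As ?gs) (reindexing C ?bm ?Xs))"
      by (rule ccomp_assoc[OF Rbm par_gs projections_hom[OF As_obj i], symmetric])
    finally show "ccomp C (projections C As ! i) (ccomp C (reindexing C \<sigma> Bs) (parallel Bs fs)) =
        ccomp C (projections C As ! i) (ccomp C (parallel As ?gs) (reindexing C ?bm ?Xs))" .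
  qed
qed

text \<open>The formula for \<open>perm N\<close> makes sense along every mapping, because
  projections may be repeated and left out; hence \<open>perm N\<close> itself is the cartesian
  action.\<close>

lemma cartesian_action_times: "cartesian_action N (perm N)"
proof (intro cartesian_action.intro mapping_action.intro multicategory_times mapping_action_axioms.intro)
  show hom: "perm N \<sigma> Bs f \<in> hom N Bs (trg N f)" if "acts_on N is_mapping \<sigma> Bs f" for \<sigma> Bs f
    using acts_on_times[OF that] ccomp_hom[OF reindexing_hom snd_hom_times]
    by (simp add: hom_times)
  show "perm N [0..<length (src N f)] (src N f) f = f" if "f \<in> arr N" for f
    using that reindexing_id[of "fst f"] cident_right[OF snd_hom_times[OF that]]
    by (simp add: arr_times)
  show "perm N \<rho> Cs (perm N \<sigma> Bs f) = perm N (map ((!) \<rho>) \<sigma>) Cs f"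
    if \<sigma>: "acts_on N is_mapping \<sigma> Bs f" and \<rho>: "acts_on N is_mapping \<rho> Cs (perm N \<sigma> Bs f)"
    for \<sigma> \<rho> Bs Cs f
  proof -
    note \<sigma>' = acts_on_times[OF \<sigma>] and \<rho>' = acts_on_times(1-3)[OF \<rho>, simplified]
    show ?thesis
      using ccomp_assoc[OF reindexing_hom[OF \<rho>'] reindexing_hom[OF \<sigma>'(1-3)] snd_hom_times[OF \<sigma>'(4)]]
        reindexing_comp[OF \<sigma>'(1,2) \<rho>'] by simp
  qed
  show "mcomp N f (map (\<lambda>i. perm N (\<sigma>s ! i) (Bss ! i) (fs ! i)) [0..<length fs]) =
      perm N (juxtapose (map length Bss) \<sigma>s) (concat Bss) (mcomp N f fs)"
    if f: "composable N f fs" and len: "length \<sigma>s = length fs" "length Bss = length fs"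
      and act: "\<And>i. i < length fs \<Longrightarrow> acts_on N is_mapping (\<sigma>s ! i) (Bss ! i) (fs ! i)"
    for f fs \<sigma>s Bss
  proof -
    note f' = composable_times[OF f]
    note J = acts_on_juxtapose[OF len act, unfolded times_simps]
    have src: "concat (map fst (map (\<lambda>i. perm N (\<sigma>s ! i) (Bss ! i) (fs ! i)) [0..<length fs])) =
        concat Bss"
      by (rule arg_cong[where f = concat], rule nth_equalityI) (use len in simp_all)
    show ?thesis
      using parallel_act_right[OF f'(3,4) len act] src
        ccomp_assoc[OF reindexing_hom[OF J] parallel_hom[OF f'(3,4)] f'(2)]
      by (simp add: times_comp_eq)
  qed
  show "mcomp N (perm N \<sigma> Bs f) fs =
      perm N (block_mapping (map (\<lambda>g. length (src N g)) fs) \<sigma>) (concat (map (src N) fs))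
        (mcomp N f (map ((!) fs) \<sigma>))"
    if f: "acts_on N is_mapping \<sigma> Bs f" and fs: "set fs \<subseteq> arr N" and Bs: "map (trg N) fs = Bs"
    for \<sigma> Bs f fs
  proof -
    note f' = acts_on_times[OF f]
    let ?ms = "map (\<lambda>f. length (fst f)) fs" and ?gs = "map ((!) fs) \<sigma>"
    have \<sigma>: "s < length fs" if "s \<in> set \<sigma>" for s
      using subsetD[OF f'(2) that] Bs by auto
    have gs: "set ?gs \<subseteq> arr N" "map (trg N) ?gs = fst f"
      using fs \<sigma> by (auto simp: Bs[symmetric] f'(3)[symmetric])
    have bm: "set (block_mapping ?ms \<sigma>) \<subseteq> {..<length (concat (map fst fs))}"
      "map ((!) (concat (map fst fs))) (block_mapping ?ms \<sigma>) = concat (map fst ?gs)"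
      using block_mapping_fst \<sigma> by blast+
    show ?thesis
      using reindexing_parallel[OF fs Bs f'(2,3)]
        ccomp_assoc[OF parallel_hom[OF fs Bs] reindexing_hom[OF f'(1-3)] snd_hom_times[OF f'(4)]]
        ccomp_assoc[OF reindexing_hom[OF concat_fst_obj[OF fs] bm] parallel_hom[OF gs]
          snd_hom_times[OF f'(4)]]
      by (simp add: times_comp_eq)
  qed
qed

text \<open>The product of \<open>[product C As]\<close> need not be \<open>product C As\<close>, so
  the projections of \<open>C\<close> enter \<open>N\<close> through one further projection.\<close>

lemma universal_product_times:
  assumes As: "set As \<subseteq> cobj C"
  shows "universal_product N As (product C As)
    (map (\<lambda>p. ([product C As], ccomp C p (projections C [product C As] ! 0))) (projections C As))"
    (is "universal_product N As ?P ?ps")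
proof -
  interpret N: multicategory N
    by (rule multicategory_times)
  have P: "set [?P] \<subseteq> cobj C"
    using product_obj[OF As] by simp
  \<comment> \<open>The further projection cancels, so the universal property in \<open>N\<close> at
    \<open>Xs\<close> is that of \<open>product C As\<close> in \<open>C\<close>, tested at the
    object \<open>product C Xs\<close>.\<close>
  have comp: "map (\<lambda>p. mcomp N p [t]) ?ps =
      map (\<lambda>p. (Xs, ccomp C p (snd t))) (projections C As)"
    if t: "t \<in> hom N Xs ?P" for t Xs
  proof -
    have "mcomp N ([?P], ccomp C p (projections C [?P] ! 0)) [t] = (Xs, ccomp C p (snd t))"
      if p: "p \<in> set (projections C As)" for p
    proof -
      obtain A where "p \<in> chom C ?P A"
        using p projections_hom[OF As] length_projections[OF As] by (auto simp: in_set_conv_nth)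
      then show ?thesis
        using times_comp_unary_ident[of t p A] homD[OF t] by simp
    qed
    then show ?thesis
      by simp
  qed
  show ?thesis
  proof (rule N.universal_productI)
    show "?P \<in> obj N"
      using P by simp
    have "projections C [?P] ! 0 \<in> chom C (product C [?P]) ?P"
      using projections_hom[OF P, of 0] by simp
    from ccomp_hom[OF this projections_hom[OF As]] show "cone N [?P] ?ps As"
      using P
      by (simp add: list_all2_conv_all_nth hom_times length_projections[OF As])
  next
    fix Xs fs
    assume "set Xs \<subseteq> obj N" and fs: "cone N Xs fs As"
    then have Xs: "set Xs \<subseteq> cobj C"
      by simp
    have len: "length (map snd fs) = length As"
      using fs by (simp add: list_all2_lengthD)
    have comps: "map snd fs ! i \<in> chom C (product C Xs) (As ! i)" "fst (fs ! i) = Xs"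
      if "i < length As" for i
      using fs that by (auto simp: list_all2_conv_all_nth hom_times)
    let ?t = "(Xs, tuple C (product C Xs) As (map snd fs))"
    have t: "?t \<in> hom N Xs ?P"
      using tuple_hom[OF As product_obj[OF Xs] len comps(1)] Xs by (simp add: hom_times)
    have "map (\<lambda>p. mcomp N p [?t]) ?ps = fs"
      unfolding comp[OF t]
    proof (rule nth_equalityI)
      show "length (map (\<lambda>p. (Xs, ccomp C p (snd ?t))) (projections C As)) = length fs"
        using len by (simp add: length_projections[OF As])
      fix i assume "i < length (map (\<lambda>p. (Xs, ccomp C p (snd ?t))) (projections C As))"
      then have i: "i < length As"
        by (simp add: length_projections[OF As])
      then show "map (\<lambda>p. (Xs, ccomp C p (snd ?t))) (projections C As) ! i = fs ! i"
        using proj_tuple[OF As product_obj[OF Xs] len comps(1) i] comps(2)[OF i] len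
        by (simp add: length_projections[OF As] prod_eq_iff)
    qed
    with t show "\<exists>t. t \<in> hom N Xs ?P \<and> map (\<lambda>p. mcomp N p [t]) ?ps = fs"
      by blast
  next
    fix Xs t t'
    assume t: "t \<in> hom N Xs ?P" and t': "t' \<in> hom N Xs ?P"
      and eq: "map (\<lambda>p. mcomp N p [t]) ?ps = map (\<lambda>p. mcomp N p [t']) ?ps"
    have "snd t = snd t'"
    proof (rule product_ext[OF As])
      show "snd t \<in> chom C (product C Xs) ?P" "snd t' \<in> chom C (product C Xs) ?P"
        using t t' by (simp_all add: hom_times)
      show "ccomp C (projections C As ! i) (snd t) = ccomp C (projections C As ! i) (snd t')"
        if "i < length As" for i
        using eq that unfolding comp[OF t] comp[OF t'] by (simp add: length_projections[OF As])
    qed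
    then show "t = t'"
      using t t' by (simp add: hom_times prod_eq_iff)
  qed
qed

end


section \<open>Algebraic products, universal products and preuniversal arrows\<close>

context cartesian_action
begin

lemma coords_cone: "set As \<subseteq> obj M \<Longrightarrow> cone M As (map (coord As) [0..<length As]) As"
  using coord_hom by (simp add: list_all2_conv_all_nth)

text \<open>For the source \<open>[C]\<close> the contraction in \<open>clone_comp\<close> is the
  constant mapping \<open>replicate (length As) 0\<close>, so the definition becomes two equations
  of the clone.\<close>

lemma algebraic_product_iff:
  "algebraic_product M act As C ps u \<longleftrightarrow>
    cone M [C] ps As \<and> u \<in> hom M As C \<and> clone_comp u [C] ps = ident M C \<and>
    map (\<lambda>p. mcomp M p [u]) ps = map (coord As) [0..<length As]"
proof (cases "length ps = length As")
  case True
  have "map (\<lambda>p. mcomp M p [u]) ps = map (coord As) [0..<length As] \<longleftrightarrow>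
      (\<forall>i < length As. mcomp M (ps ! i) [u] = act [i] As (ident M (As ! i)))"
    unfolding list_eq_iff_nth_eq by (simp add: True coord_def)
  moreover have "clone_comp u [C] ps = act (replicate (length As) 0) [C] (mcomp M u ps)"
    by (simp add: True clone_comp_def)
  ultimately show ?thesis
    unfolding algebraic_product_def list_all2_conv_all_nth by (auto dest: hom_obj)
next
  case False
  then show ?thesis
    by (auto simp: algebraic_product_def dest: list_all2_lengthD)
qed

section \<open>Consequences of a fixed algebraic product\<close>

context
  fixes As C ps u
  assumes alg: "algebraic_product M act As C ps u"
begin

lemma algebraic_product_facts:
  shows "cone M [C] ps As" "u \<in> hom M As C" "clone_comp u [C] ps = ident M C"
    "map (\<lambda>p. mcomp M p [u]) ps = map (coord As) [0..<length As]"
    "set As \<subseteq> obj M" "C \<in> obj M"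
  using alg hom_obj by (auto simp: algebraic_product_iff)

text \<open>Moving \<open>u\<close> inside the contraction turns each \<open>p_i\<close> into
  \<open>p_i u\<close>, which is the variable \<open>x_i\<close>, and
  \<open>h(x_1, ..., x_n)\<close> is \<open>h\<close>.\<close>

lemma algebraic_product_factor:
  "h \<in> hom M As B \<Longrightarrow> mcomp M (clone_comp h [C] ps) [u] = h"
  using clone_comp_mcomp[OF _ algebraic_product_facts(1,2)] algebraic_product_facts(4)
    clone_comp_coords by simp

text \<open>Substituting the projections into \<open>g u\<close> gives \<open>g\<close> after
  \<open>u(p_1, ..., p_n)\<close>, that is, after the identity.\<close>

lemma algebraic_product_cancel:
  "g \<in> hom M [C] B \<Longrightarrow> clone_comp (mcomp M g [u]) [C] ps = g"
  using mcomp_clone_comp[OF _ algebraic_product_facts(2,1)] algebraic_product_facts(3,6)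
    mcomp_unary_ident by simp

lemma algebraic_product_universal: "universal_product M As C ps"
proof (rule universal_productI[OF algebraic_product_facts(6,1)])
  fix Xs fs
  assume Xs: "set Xs \<subseteq> obj M" and fs: "cone M Xs fs As"
  let ?t = "clone_comp u Xs fs"
  have len: "length ps = length As" "length fs = length As"
    using algebraic_product_facts(1) fs by (simp_all add: list_all2_lengthD)
  have "map (\<lambda>p. mcomp M p [?t]) ps = fs"
  proof (rule nth_equalityI)
    fix i assume "i < length (map (\<lambda>p. mcomp M p [?t]) ps)"
    then have i: "i < length As"
      using len by simp
    then have pi: "ps ! i \<in> hom M [C] (As ! i)"
      using algebraic_product_facts(1) by (simp add: list_all2_conv_all_nth)
    have "mcomp M (ps ! i) [u] = coord As i"
      using arg_cong[OF algebraic_product_facts(4), of "\<lambda>xs. xs ! i"] i len by simp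
    then show "map (\<lambda>p. mcomp M p [?t]) ps ! i = fs ! i"
      using mcomp_clone_comp[OF pi algebraic_product_facts(2) fs Xs] clone_comp_coord[OF fs Xs i] i len
      by simp
  qed (use len in simp)
  then show "\<exists>t. t \<in> hom M Xs C \<and> map (\<lambda>p. mcomp M p [t]) ps = fs"
    using clone_comp_hom[OF algebraic_product_facts(2) fs Xs] by blast
next
  fix Xs t t'
  assume t: "t \<in> hom M Xs C" and t': "t' \<in> hom M Xs C"
    and eq: "map (\<lambda>p. mcomp M p [t]) ps = map (\<lambda>p. mcomp M p [t']) ps"
  \<comment> \<open>As \<open>u(p_1, ..., p_n)\<close> is the identity, composing it with
    \<open>s\<close> and moving \<open>s\<close> inwards expresses \<open>s\<close> by its
    components.\<close>
  have "s = clone_comp u Xs (map (\<lambda>p. mcomp M p [s]) ps)" if "s \<in> hom M Xs C" for s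
    using clone_comp_mcomp[OF algebraic_product_facts(2,1) that] mcomp_ident_unary[OF that]
      algebraic_product_facts(3) by simp
  then show "t = t'"
    using t t' eq by metis
qed

lemma algebraic_product_preuniversal: "preuniversal M u"
  unfolding preuniversal_def
proof (intro conjI ballI)
  fix B assume "B \<in> obj M"
  note u = homD[OF algebraic_product_facts(2)]
  have "bij_betw (\<lambda>g. mcomp M g [u]) (hom M [C] B) (hom M As B)"
    by (rule bij_betw_byWitness[where f' = "\<lambda>h. clone_comp h [C] ps"])
      (use algebraic_product_cancel algebraic_product_factor mcomp_unary_hom clone_comp_hom
        algebraic_product_facts in auto)
  then show "bij_betw (\<lambda>g. mcomp M g [u]) (hom M [trg M u] B) (hom M (src M u) B)"
    using u by simp
qed (use homD[OF algebraic_product_facts(2)] in simp)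

end

text \<open>The equation for the identity is checked on components: \<open>p_i\<close> after
  \<open>u(p_1, ..., p_n)\<close> is the variable \<open>x_i\<close> evaluated at the projections,
  which is \<open>p_i\<close>.\<close>

lemma universal_product_algebraic:
  assumes univ: "universal_product M As C ps" and u: "u \<in> hom M As C"
    and pu: "map (\<lambda>p. mcomp M p [u]) ps = map (coord As) [0..<length As]"
  shows "algebraic_product M act As C ps u"
proof -
  have ps: "cone M [C] ps As" and C: "set [C] \<subseteq> obj M"
    using universal_product_proj[OF univ] by simp_all
  have len: "length ps = length As"
    using ps by (rule list_all2_lengthD)
  have "clone_comp u [C] ps = ident M C"
  proof (rule universal_product_ext[OF univ clone_comp_hom[OF u ps C]])
    show "ident M C \<in> hom M [C] C"
      using C by (simp add: ident_hom)
    show "map (\<lambda>p. mcomp M p [clone_comp u [C] ps]) ps = map (\<lambda>p. mcomp M p [ident M C]) ps"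
    proof (rule nth_equalityI)
      fix i assume "i < length (map (\<lambda>p. mcomp M p [clone_comp u [C] ps]) ps)"
      then have i: "i < length As"
        using len by simp
      then have pi: "ps ! i \<in> hom M [C] (As ! i)"
        using ps by (simp add: list_all2_conv_all_nth)
      have "mcomp M (ps ! i) [u] = coord As i"
        using arg_cong[OF pu, of "\<lambda>xs. xs ! i"] i len by simp
      then show "map (\<lambda>p. mcomp M p [clone_comp u [C] ps]) ps ! i =
          map (\<lambda>p. mcomp M p [ident M C]) ps ! i"
        using mcomp_clone_comp[OF pi u ps C] clone_comp_coord[OF ps C i] mcomp_unary_ident[OF pi] i len
        by simp
    qed simp
  qed
  then show ?thesis
    using ps u pu by (simp add: algebraic_product_iff)
qed

lemma preuniversal_algebraic:
  assumes pre: "preuniversal M u" and u: "u \<in> hom M As C"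
  obtains ps where "algebraic_product M act As C ps u"
proof -
  note obj = hom_obj[OF u]
  have bij: "bij_betw (\<lambda>g. mcomp M g [u]) (hom M [C] B) (hom M As B)" if "B \<in> obj M" for B
    using pre that homD[OF u] by (simp add: preuniversal_def)
  have "\<exists>p. p \<in> hom M [C] (As ! i) \<and> mcomp M p [u] = coord As i" if "i < length As" for i
    using bij_betw_imp_surj_on[OF bij, of "As ! i"] coord_hom[OF obj(1) that] obj(1) that
    by (metis (no_types, lifting) image_iff nth_mem subsetD)
  then obtain p where p: "\<And>i. i < length As \<Longrightarrow> p i \<in> hom M [C] (As ! i)"
    "\<And>i. i < length As \<Longrightarrow> mcomp M (p i) [u] = coord As i"
    by metis
  let ?ps = "map p [0..<length As]"
  have ps: "cone M [C] ?ps As"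
    using p(1) by (simp add: list_all2_conv_all_nth)
  have pu: "map (\<lambda>p. mcomp M p [u]) ?ps = map (coord As) [0..<length As]"
    using p(2) by simp
  have C: "set [C] \<subseteq> obj M"
    using obj by simp
  \<comment> \<open>Composed with \<open>u\<close>, both \<open>u(p_1, ..., p_n)\<close> and the
    identity give \<open>u\<close>, the former as \<open>u(x_1, ..., x_n)\<close>; injectivity of
    composition with \<open>u\<close> makes them equal.\<close>
  have "mcomp M (clone_comp u [C] ?ps) [u] = u"
    unfolding clone_comp_mcomp[OF u ps u] pu by (rule clone_comp_coords[OF u])
  then have "clone_comp u [C] ?ps = ident M C"
    using bij_betw_imp_inj_on[OF bij[OF obj(2)]] clone_comp_hom[OF u ps C] ident_hom[OF obj(2)]
      mcomp_ident_unary[OF u] by (simp add: inj_on_def)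
  then show ?thesis
    using that ps u pu unfolding algebraic_product_iff by blast
qed

text \<open>In one direction \<open>u\<close> is the tuple of the variables. The left side does not
  mention \<open>act\<close>, so the right side has the same truth value for all actions.\<close>

lemma has_universal_products_iff: "has_universal_products M \<longleftrightarrow> has_algebraic_products M act"
proof
  assume univ: "has_universal_products M"
  show "has_algebraic_products M act"
    unfolding has_algebraic_products_def
  proof (intro allI impI)
    fix As assume As: "set As \<subseteq> obj M"
    then obtain C ps where C: "universal_product M As C ps"
      using univ by (auto simp: has_universal_products_def)
    obtain u where "u \<in> hom M As C" "map (\<lambda>p. mcomp M p [u]) ps = map (coord As) [0..<length As]"
      by (rule universal_product_exists[OF C As coords_cone[OF As]])
    then show "\<exists>C ps u. algebraic_product M act As C ps u"
      using universal_product_algebraic[OF C] by blast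
  qed
next
  assume "has_algebraic_products M act"
  then show "has_universal_products M"
    unfolding has_algebraic_products_def has_universal_products_def
    using algebraic_product_universal by meson
qed

text \<open>The composite is exhibited as the \<open>u\<close> of an algebraic product of the
  concatenated family. \<open>universal_product_concat\<close> provides the object and its
  projections; it remains to see that these turn the composite into the variables.\<close>

lemma preuniversal_mcomp:
  assumes uus: "composable M u us" and u: "preuniversal M u"
    and us: "\<And>v. v \<in> set us \<Longrightarrow> preuniversal M v"
  shows "preuniversal M (mcomp M u us)"
proof -
  let ?Ass = "map (src M) us" and ?Cs = "src M u" and ?C = "trg M u"
  let ?Xs = "concat ?Ass" and ?ms = "map (\<lambda>v. length (src M v)) us"
  let ?w = "mcomp M u us"
  have arr: "u \<in> arr M" "set us \<subseteq> arr M" and Cs: "map (trg M) us = ?Cs"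
    using uus by (simp_all add: composable_def)
  have lenC: "length ?Cs = length us"
    using Cs by (metis length_map)
  obtain ps where ps: "algebraic_product M act ?Cs ?C ps u"
    using preuniversal_algebraic[OF u homI[OF arr(1) refl refl]] .
  have v: "us ! j \<in> hom M (?Ass ! j) (?Cs ! j)" if "j < length us" for j
    using subsetD[OF arr(2) nth_mem[OF that]] that by (simp add: hom_def flip: Cs)
  have "\<exists>qs. algebraic_product M act (?Ass ! j) (?Cs ! j) qs (us ! j)" if "j < length us" for j
    using preuniversal_algebraic[OF us v[OF that]] that by (metis nth_mem)
  then obtain qs where qs:
    "\<And>j. j < length us \<Longrightarrow> algebraic_product M act (?Ass ! j) (?Cs ! j) (qs j) (us ! j)"
    by metis
  let ?pss = "map qs [0..<length us]"
  let ?rss = "map2 (\<lambda>qs p. map (\<lambda>q. mcomp M q [p]) qs) ?pss ps"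
  have w: "?w \<in> hom M ?Xs ?C"
    using mcomp_hom[OF uus] .
  have lenp: "length ps = length us"
    using algebraic_product_facts(1)[OF ps] lenC by (simp add: list_all2_lengthD)
  have univ: "universal_product M ?Xs ?C (concat ?rss)"
    by (rule universal_product_concat[OF algebraic_product_universal[OF ps]])
      (use algebraic_product_universal[OF qs] lenC in simp_all)
  \<comment> \<open>Kept as one list per \<open>j\<close>, since the computation depends on the
    block; \<open>concat_blocks\<close> flattens the result.\<close>
  have "map (map (\<lambda>r. mcomp M r [?w])) ?rss =
      map (\<lambda>j. map (coord ?Xs) (block ?ms j)) [0..<length us]"
  proof (rule nth_equalityI)
    fix j assume "j < length (map (map (\<lambda>r. mcomp M r [?w])) ?rss)"
    then have j: "j < length us"
      using lenp by simp
    let ?b = "block ?ms j"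
    have b: "set ?b \<subseteq> {..<length ?Xs}" "map ((!) ?Xs) ?b = ?Ass ! j"
      using set_block_subset[of j ?Ass] map_nth_concat_block[of j ?Ass] j by (simp_all add: comp_def)
    have Xs: "set ?Xs \<subseteq> obj M"
      using hom_obj[OF w] by simp
    have pj: "ps ! j \<in> hom M [?C] (?Cs ! j)"
      using algebraic_product_facts(1)[OF ps] j lenC by (simp add: list_all2_conv_all_nth)
    have "mcomp M (ps ! j) [u] = coord ?Cs j"
      using arg_cong[OF algebraic_product_facts(4)[OF ps], of "\<lambda>xs. xs ! j"] j lenC lenp by simp
    \<comment> \<open>The outer projection turns \<open>u\<close> into a variable, which picks the
      argument \<open>us ! j\<close> and pads its source to \<open>?Xs\<close>.\<close>
    then have pw: "mcomp M (ps ! j) [?w] = act ?b ?Xs (us ! j)"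
      using mcomp_unary_assoc[OF pj algebraic_product_facts(2)[OF ps] uus]
        mcomp_coord[OF _ arr(2) Cs] j lenC by simp
    have "map (\<lambda>q. mcomp M (mcomp M q [ps ! j]) [?w]) (qs j) = map (coord ?Xs) ?b"
    proof (rule nth_equalityI)
      have lenq: "length (qs j) = length (src M (us ! j))"
        using algebraic_product_facts(1)[OF qs[OF j]] j by (simp add: list_all2_lengthD)
      then show "length (map (\<lambda>q. mcomp M (mcomp M q [ps ! j]) [?w]) (qs j)) =
          length (map (coord ?Xs) ?b)"
        using j by simp
      fix k assume "k < length (map (\<lambda>q. mcomp M (mcomp M q [ps ! j]) [?w]) (qs j))"
      then have k: "k < length (src M (us ! j))" "k < length (qs j)"
        using lenq by simp_all
      have q: "qs j ! k \<in> hom M [?Cs ! j] (?Ass ! j ! k)"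
        using algebraic_product_facts(1)[OF qs[OF j]] k j by (simp add: list_all2_conv_all_nth)
      have "composable M (ps ! j) [?w]"
        using homD[OF pj] homD[OF w] by (simp add: composable_def)
      then have "mcomp M (mcomp M (qs j ! k) [ps ! j]) [?w] = mcomp M (qs j ! k) [act ?b ?Xs (us ! j)]"
        using mcomp_unary_assoc[OF q pj] pw by simp
      also have "\<dots> = act ?b ?Xs (mcomp M (qs j ! k) [us ! j])"
        by (rule mcomp_act_unary[OF q v[OF j] Xs b])
      also have "mcomp M (qs j ! k) [us ! j] = coord (?Ass ! j) k"
        using arg_cong[OF algebraic_product_facts(4)[OF qs[OF j]], of "\<lambda>xs. xs ! k"] k j by simp
      also have "act ?b ?Xs \<dots> = coord ?Xs (?b ! k)"
        using act_coord[OF Xs b(1), of k] k(1) j unfolding b(2) by simp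
      finally show "map (\<lambda>q. mcomp M (mcomp M q [ps ! j]) [?w]) (qs j) ! k = map (coord ?Xs) ?b ! k"
        using k j by simp
    qed
    then show "map (map (\<lambda>r. mcomp M r [?w])) ?rss ! j =
        map (\<lambda>j. map (coord ?Xs) (block ?ms j)) [0..<length us] ! j"
      using j lenp by (simp add: comp_def)
  qed (use lenp in simp)
  from arg_cong[OF this, of concat]
  have "map (\<lambda>r. mcomp M r [?w]) (concat ?rss) =
      map (coord ?Xs) (concat (map (block ?ms) [0..<length us]))"
    by (simp only: map_concat map_map comp_def)
  also have "concat (map (block ?ms) [0..<length us]) = [0..<length ?Xs]"
    using concat_blocks[of ?ms] by (simp add: length_concat comp_def)
  finally show ?thesis
    by (rule algebraic_product_preuniversal[OF universal_product_algebraic[OF univ w]])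
qed

lemma representable_iff: "representable M \<longleftrightarrow> has_algebraic_products M act"
proof
  assume rep: "representable M"
  show "has_algebraic_products M act"
    unfolding has_algebraic_products_def
  proof (intro allI impI)
    fix As assume "set As \<subseteq> obj M"
    then obtain u where u: "preuniversal M u" "src M u = As"
      using rep by (auto simp: representable_def)
    then have "u \<in> hom M As (trg M u)"
      by (auto simp: preuniversal_def intro: homI)
    then show "\<exists>C ps u. algebraic_product M act As C ps u"
      using preuniversal_algebraic[OF u(1)] by blast
  qed
next
  assume alg: "has_algebraic_products M act"
  have "\<exists>u. preuniversal M u \<and> src M u = As" if "set As \<subseteq> obj M" for As
    using alg that algebraic_product_preuniversal algebraic_product_facts(2) homD(2)
    unfolding has_algebraic_products_def by metis
  then show "representable M"
    using preuniversal_mcomp by (auto simp: representable_def)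
qed

end


section \<open>Reconstruction from the unary arrows\<close>

text \<open>An \<open>fp_category\<close> carries a chosen product for every sequence of objects, so
  the algebraic products are fixed as functions of \<open>As\<close>.\<close>

locale chosen_products = cartesian_action M act
  for M :: "('o, 'a, 'z) multicategory_scheme" and act +
  fixes P :: "'o list \<Rightarrow> 'o" and pr :: "'o list \<Rightarrow> 'a list" and pair :: "'o list \<Rightarrow> 'a"
  assumes algebraic: "set As \<subseteq> obj M \<Longrightarrow> algebraic_product M act As (P As) (pr As) (pair As)"
begin

definition fp :: "('o, 'a) fp_category" where
  "fp = \<lparr> cobj = obj M, carr = {f \<in> arr M. length (src M f) = 1}, cdom = (\<lambda>f. hd (src M f)),
    ccod = trg M, cident = ident M, ccomp = (\<lambda>g f. mcomp M g [f]),
    product = P, projections = pr \<rparr>"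

lemma fp_simps [simp]:
  "cobj fp = obj M" "ccod fp = trg M" "cident fp = ident M" "ccomp fp g f = mcomp M g [f]"
  "product fp = P" "projections fp = pr"
  by (simp_all add: fp_def)

lemma chom_fp [simp]: "chom fp A B = hom M [A] B"
  by (auto simp: chom_def hom_def fp_def length_Suc_conv)

lemma carr_fp: "f \<in> carr fp \<longleftrightarrow> f \<in> hom M [cdom fp f] (trg M f)"
  by (auto simp: hom_def fp_def length_Suc_conv)

sublocale fp: fp_category fp
proof
  show "cdom fp f \<in> cobj fp" "ccod fp f \<in> cobj fp" if "f \<in> carr fp" for f
    using that hom_obj by (fastforce simp: carr_fp)+
  show "ccomp fp h (ccomp fp g f) = ccomp fp (ccomp fp h g) f"
    if "f \<in> chom fp A B" "g \<in> chom fp B D" "h \<in> chom fp D E" for f g h A B D E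
    using that mcomp_unary_assoc[of h D E g "[B]" "[f]"] by (simp add: composable_def hom_def)
  show "is_product fp As (product fp As) (projections fp As)" if "set As \<subseteq> cobj fp" for As
  proof -
    \<comment> \<open>Restricting the test sources to one-object sequences \<open>[X]\<close> gives
      the product property in \<open>fp\<close>.\<close>
    have "universal_product M As (P As) (pr As)"
      using algebraic_product_universal[OF algebraic] that by simp
    then show ?thesis
      by (simp add: is_product_def universal_product_def)
  qed
qed (auto simp: ident_hom mcomp_unary_hom mcomp_ident_unary mcomp_unary_ident)

lemmas pair_facts = algebraic_product_facts[OF algebraic]

lemma proj_hom: "set As \<subseteq> obj M \<Longrightarrow> i < length As \<Longrightarrow> pr As ! i \<in> hom M [P As] (As ! i)"
  using pair_facts(1) by (simp add: list_all2_conv_all_nth)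

lemma proj_pair:
  assumes "set As \<subseteq> obj M" "i < length As"
  shows "mcomp M (pr As ! i) [pair As] = coord As i"
  using arg_cong[OF pair_facts(4)[OF assms(1)], of "\<lambda>xs. xs ! i"] assms
    list_all2_lengthD[OF pair_facts(1)[OF assms(1)]] by simp

lemma pair_ext:
  assumes As: "set As \<subseteq> obj M" and t: "t \<in> hom M Xs (P As)" "t' \<in> hom M Xs (P As)"
    and "\<And>i. i < length As \<Longrightarrow> mcomp M (pr As ! i) [t] = mcomp M (pr As ! i) [t']"
  shows "t = t'"
  by (rule universal_product_ext[OF algebraic_product_universal[OF algebraic[OF As]] t],
      rule nth_equalityI) (use assms(4) list_all2_lengthD[OF pair_facts(1)[OF As]] in simp_all)

text \<open>Both sides have the variable \<open>coord Bs (\<sigma> ! i)\<close> as component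
  \<open>i\<close>. This links the action of \<open>M\<close> to reindexing in
  \<open>fp\<close>.\<close>

lemma reindexing_pair:
  assumes Bs: "set Bs \<subseteq> obj M" and \<sigma>: "set \<sigma> \<subseteq> {..<length Bs}" and As: "map ((!) Bs) \<sigma> = As"
  shows "mcomp M (reindexing fp \<sigma> Bs) [pair Bs] = act \<sigma> Bs (pair As)"
proof -
  have As_obj: "set As \<subseteq> obj M"
    using Bs \<sigma> As by (auto simp: subset_iff)
  have R: "reindexing fp \<sigma> Bs \<in> hom M [P Bs] (P As)"
    using fp.reindexing_hom[OF _ \<sigma> As] Bs by simp
  note u = pair_facts(2)[OF Bs]
  show ?thesis
  proof (rule pair_ext[OF As_obj])
    show "mcomp M (reindexing fp \<sigma> Bs) [pair Bs] \<in> hom M Bs (P As)"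
      by (rule mcomp_unary_hom[OF R u])
    show "act \<sigma> Bs (pair As) \<in> hom M Bs (P As)"
      by (rule act_in_hom[OF pair_facts(2)[OF As_obj] Bs \<sigma> As])
    fix i assume i: "i < length As"
    then have i': "i < length \<sigma>"
      using As by auto
    then have \<sigma>i: "\<sigma> ! i < length Bs"
      using \<sigma> nth_mem by blast
    have "composable M (reindexing fp \<sigma> Bs) [pair Bs]"
      using homD[OF R] homD[OF u] by (simp add: composable_def)
    then have "mcomp M (pr As ! i) [mcomp M (reindexing fp \<sigma> Bs) [pair Bs]] =
        mcomp M (mcomp M (pr As ! i) [reindexing fp \<sigma> Bs]) [pair Bs]"
      using mcomp_unary_assoc[OF proj_hom[OF As_obj i] R] by simp
    also have "\<dots> = coord Bs (\<sigma> ! i)"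
      using fp.proj_reindexing[OF _ \<sigma> As i] Bs proj_pair[OF Bs \<sigma>i] by simp
    also have "\<dots> = act \<sigma> Bs (coord As i)"
      using act_coord[OF Bs \<sigma> i'] As by simp
    also have "\<dots> = mcomp M (pr As ! i) [act \<sigma> Bs (pair As)]"
      using mcomp_act_unary[OF proj_hom[OF As_obj i] pair_facts(2)[OF As_obj] Bs \<sigma> As]
        proj_pair[OF As_obj i] by simp
    finally show "mcomp M (pr As ! i) [mcomp M (reindexing fp \<sigma> Bs) [pair Bs]] =
        mcomp M (pr As ! i) [act \<sigma> Bs (pair As)]" .
  qed
qed

section \<open>Factoring arrows through \<open>pair\<close>\<close>

definition factor :: "'a \<Rightarrow> 'a" where
  "factor f = clone_comp f [P (src M f)] (pr (src M f))"

lemma factor_hom: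
  assumes "f \<in> hom M As B"
  shows "factor f \<in> hom M [P As] B"
proof -
  have As: "set As \<subseteq> obj M"
    using hom_obj[OF assms] by simp
  then show ?thesis
    using clone_comp_hom[OF assms pair_facts(1)] pair_facts(6)[OF As] homD[OF assms]
    by (simp add: factor_def)
qed

lemma factor_pair:
  assumes "f \<in> hom M As B"
  shows "mcomp M (factor f) [pair As] = f"
  using algebraic_product_factor[OF algebraic assms] hom_obj[OF assms] homD[OF assms]
  by (simp add: factor_def)

lemma factor_unique:
  assumes "set As \<subseteq> obj M" "g \<in> hom M [P As] B"
  shows "factor (mcomp M g [pair As]) = g"
  using algebraic_product_cancel[OF algebraic assms(2)] assms(1)
    homD[OF mcomp_unary_hom[OF assms(2) pair_facts(2)[OF assms(1)]]]
  by (simp add: factor_def)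

text \<open>\<open>reindexing_pair\<close> trades the reindexing for the action on
  \<open>pair As\<close>, and by law (i) this action passes through the unary
  \<open>factor f\<close>.\<close>

lemma factor_reindexing:
  assumes f: "f \<in> hom M As B"
    and \<sigma>: "set Bs \<subseteq> obj M" "set \<sigma> \<subseteq> {..<length Bs}" "map ((!) Bs) \<sigma> = As"
  shows "mcomp M (mcomp M (factor f) [reindexing fp \<sigma> Bs]) [pair Bs] = act \<sigma> Bs f"
proof -
  have R: "reindexing fp \<sigma> Bs \<in> hom M [P Bs] (P As)"
    using fp.reindexing_hom[OF _ \<sigma>(2,3)] \<sigma>(1) by simp
  have "composable M (reindexing fp \<sigma> Bs) [pair Bs]"
    using homD[OF R] homD[OF pair_facts(2)[OF \<sigma>(1)]] by (simp add: composable_def)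
  then have "mcomp M (mcomp M (factor f) [reindexing fp \<sigma> Bs]) [pair Bs] =
      mcomp M (factor f) [act \<sigma> Bs (pair As)]"
    using mcomp_unary_assoc[OF factor_hom[OF f] R] reindexing_pair[OF \<sigma>] by simp
  also have "\<dots> = act \<sigma> Bs (mcomp M (factor f) [pair As])"
    using hom_obj[OF f] by (intro mcomp_act_unary[OF factor_hom[OF f] pair_facts(2) \<sigma>])
  finally show ?thesis
    using factor_pair[OF f] by simp
qed

abbreviation rep :: "'a \<Rightarrow> 'o list \<times> 'a" where
  "rep f \<equiv> (src M f, factor f)"

lemma rep_hom: "f \<in> hom M As B \<Longrightarrow> rep f \<in> hom fp.N As B"
  using factor_hom hom_obj homD by (simp add: fp.hom_times)

lemma rep_arr: "f \<in> arr M \<Longrightarrow> rep f \<in> arr fp.N"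
  by (rule homD(1)[OF rep_hom[OF homI[OF _ refl refl]]])

lemma rep_bij: "bij_betw rep (arr M) (arr fp.N)"
proof (rule bij_betw_byWitness[where f' = "\<lambda>(As, g). mcomp M g [pair As]"])
  show "\<forall>f \<in> arr M. (\<lambda>(As, g). mcomp M g [pair As]) (rep f) = f"
    using factor_pair homI by fastforce
  have *: "mcomp M g [pair As] \<in> hom M As (trg M g) \<and> factor (mcomp M g [pair As]) = g"
    if "(As, g) \<in> arr fp.N" for As g
    using that mcomp_unary_hom[OF _ pair_facts(2)] factor_unique by (auto simp: fp.arr_times)
  then show "\<forall>x \<in> arr fp.N. rep ((\<lambda>(As, g). mcomp M g [pair As]) x) = x"
    by (auto dest: homD)
  show "rep ` arr M \<subseteq> arr fp.N"
    using rep_arr by blast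
  show "(\<lambda>(As, g). mcomp M g [pair As]) ` arr fp.N \<subseteq> arr M"
    using * by (auto dest: homD(1))
qed

text \<open>The identity of \<open>A\<close> is the only variable of \<open>[A]\<close>, so
  factoring it yields the projection that serves as identity in the multicategory of
  \<open>fp\<close>.\<close>

lemma rep_ident:
  assumes A: "A \<in> obj M"
  shows "rep (ident M A) = ident fp.N A"
proof -
  have As: "set [A] \<subseteq> obj M"
    using A by simp
  have "coord [A] 0 = ident M A"
    using act_ident[OF ident_hom[OF A]] by (simp add: coord_def)
  then show ?thesis
    using clone_comp_coord[OF pair_facts(1)[OF As], of 0] pair_facts(6)[OF As] homD[OF ident_hom[OF A]]
    by (simp add: factor_def)
qed

lemma rep_act:
  assumes f: "f \<in> hom M As B"
    and \<sigma>: "set Bs \<subseteq> obj M" "set \<sigma> \<subseteq> {..<length Bs}" "map ((!) Bs) \<sigma> = As"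
  shows "rep (act \<sigma> Bs f) = perm fp.N \<sigma> Bs (rep f)"
proof -
  have R: "reindexing fp \<sigma> Bs \<in> hom M [P Bs] (P As)"
    using fp.reindexing_hom[OF _ \<sigma>(2,3)] \<sigma>(1) by simp
  show ?thesis
    using factor_unique[OF \<sigma>(1) mcomp_unary_hom[OF factor_hom[OF f] R]] factor_reindexing[OF f \<sigma>]
      homD[OF act_in_hom[OF f \<sigma>]] by simp
qed

lemma map_trg_rep:
  assumes "set fs \<subseteq> arr M"
  shows "map (trg fp.N) (map rep fs) = map (trg M) fs"
proof -
  have "trg M (factor f) = trg M f" if "f \<in> set fs" for f
    using homD(3)[OF factor_hom[OF homI]] that assms by auto
  then show ?thesis
    by simp
qed

text \<open>Component \<open>j\<close> of both sides is \<open>fs ! j\<close> padded along block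
  \<open>j\<close>: on the left by \<open>factor_reindexing\<close>, on the right because
  \<open>pair As\<close> projects to a variable, which \<open>mcomp_coord\<close> evaluates.\<close>

lemma parallel_pair:
  assumes fs: "set fs \<subseteq> arr M" and As: "map (trg M) fs = As"
  shows "mcomp M (fp.parallel As (map rep fs)) [pair (concat (map (src M) fs))] = mcomp M (pair As) fs"
    (is "mcomp M ?par [pair ?Xs] = _")
proof -
  have rep: "set (map rep fs) \<subseteq> arr fp.N"
    using rep_arr fs by auto
  have trg: "map (trg fp.N) (map rep fs) = As"
    unfolding map_trg_rep[OF fs] by (rule As)
  have src: "concat (map fst (map rep fs)) = ?Xs"
    by (simp add: comp_def)
  have Xs: "set ?Xs \<subseteq> obj M" and As_obj: "set As \<subseteq> obj M"
    using fs src_obj trg_obj As by fastforce+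
  have par: "?par \<in> hom M [P ?Xs] (P As)"
    using fp.parallel_hom[OF rep trg] unfolding src by simp
  have comp: "composable M (pair As) fs"
    using homD[OF pair_facts(2)[OF As_obj]] fs As by (simp add: composable_def)
  have comp_par: "composable M ?par [pair ?Xs]"
    using homD[OF par] homD[OF pair_facts(2)[OF Xs]] by (simp add: composable_def)
  show ?thesis
  proof (rule pair_ext[OF As_obj])
    show "mcomp M ?par [pair ?Xs] \<in> hom M ?Xs (P As)"
      by (rule mcomp_unary_hom[OF par pair_facts(2)[OF Xs]])
    show "mcomp M (pair As) fs \<in> hom M ?Xs (P As)"
      using mcomp_hom[OF comp] homD[OF pair_facts(2)[OF As_obj]] by simp
    fix j assume j': "j < length As"
    then have j: "j < length fs"
      using As by auto
    let ?b = "block (map (\<lambda>f. length (src M f)) fs) j"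
    have b: "set ?b \<subseteq> {..<length ?Xs}" "map ((!) ?Xs) ?b = src M (fs ! j)"
      using set_block_subset[of j "map (src M) fs"] map_nth_concat_block[of j "map (src M) fs"] j
      by (simp_all add: comp_def)
    have fj: "fs ! j \<in> hom M (src M (fs ! j)) (As ! j)"
      using subsetD[OF fs nth_mem[OF j]] j by (simp add: hom_def flip: As)
    have "mcomp M (pr As ! j) [mcomp M ?par [pair ?Xs]] = mcomp M (mcomp M (pr As ! j) [?par]) [pair ?Xs]"
      using mcomp_unary_assoc[OF proj_hom[OF As_obj j'] par comp_par] by simp
    also have "\<dots> = act ?b ?Xs (fs ! j)"
      using fp.proj_parallel[OF rep trg, of j] factor_reindexing[OF fj Xs b] j unfolding src
      by (simp add: comp_def)
    also have "\<dots> = mcomp M (coord As j) fs"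
      by (rule mcomp_coord[OF j' fs As, symmetric])
    also have "\<dots> = mcomp M (pr As ! j) [mcomp M (pair As) fs]"
      using mcomp_unary_assoc[OF proj_hom[OF As_obj j'] pair_facts(2)[OF As_obj] comp]
        proj_pair[OF As_obj j'] by simp
    finally show "mcomp M (pr As ! j) [mcomp M ?par [pair ?Xs]] =
      mcomp M (pr As ! j) [mcomp M (pair As) fs]" .
  qed
qed

text \<open>By \<open>factor_unique\<close> the comparison may be made after composing with
  \<open>pair\<close>; there \<open>parallel_pair\<close> brings out \<open>factor f\<close> after
  \<open>pair\<close>, which is \<open>f\<close>.\<close>

lemma rep_mcomp:
  assumes comp: "composable M f fs"
  shows "rep (mcomp M f fs) = mcomp fp.N (rep f) (map rep fs)"
proof -
  let ?As = "src M f" and ?Xs = "concat (map (src M) fs)"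
  let ?par = "fp.parallel ?As (map rep fs)"
  have f: "f \<in> hom M ?As (trg M f)" and fs: "set fs \<subseteq> arr M" and As: "map (trg M) fs = ?As"
    using comp by (auto simp: composable_def intro: homI)
  have As_obj: "set ?As \<subseteq> obj M"
    using hom_obj[OF f] by simp
  have Xs: "set ?Xs \<subseteq> obj M"
    using hom_obj[OF mcomp_hom[OF comp]] by simp
  have "set (map rep fs) \<subseteq> arr fp.N"
    using rep_arr fs by auto
  moreover have "map (trg fp.N) (map rep fs) = ?As"
    unfolding map_trg_rep[OF fs] by (rule As)
  ultimately have par: "?par \<in> hom M [P ?Xs] (P ?As)"
    using fp.parallel_hom[of "map rep fs" ?As] by (simp add: comp_def)
  have comp_par: "composable M ?par [pair ?Xs]"
    using homD[OF par] homD[OF pair_facts(2)[OF Xs]] by (simp add: composable_def)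
  have comp_u: "composable M (pair ?As) fs"
    using homD[OF pair_facts(2)[OF As_obj]] fs As by (simp add: composable_def)
  have "mcomp M (mcomp M (factor f) [?par]) [pair ?Xs] = mcomp M (factor f) [mcomp M (pair ?As) fs]"
    using mcomp_unary_assoc[OF factor_hom[OF f] par comp_par] parallel_pair[OF fs As] by simp
  also have "\<dots> = mcomp M f fs"
    using mcomp_unary_assoc[OF factor_hom[OF f] pair_facts(2)[OF As_obj] comp_u] factor_pair[OF f]
    by simp
  finally have "factor (mcomp M f fs) = mcomp M (factor f) [?par]"
    using factor_unique[OF Xs mcomp_unary_hom[OF factor_hom[OF f] par]] by simp
  then show ?thesis
    using homD[OF mcomp_hom[OF comp]] by (simp add: fp.times_comp_eq comp_def)
qed

end


section \<open>Transfer along an isomorphism\<close>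

text \<open>\<open>N\<close> is known to be cartesian, \<open>M\<close> only to be a multicategory.
  Since \<open>G\<close> is a bijection on all arrows at once, its inverse respects hom-sets only by
  way of the injectivity of \<open>F\<close>.\<close>

locale multicategory_iso = M: multicategory M + N: cartesian_action N actN
  for M :: "('o, 'a, 'z) multicategory_scheme"
    and N :: "('p, 'b, 'y) multicategory_scheme" and actN +
  fixes F :: "'o \<Rightarrow> 'p" and G :: "'a \<Rightarrow> 'b"
  assumes bij_obj: "bij_betw F (obj M) (obj N)"
    and bij_arr: "bij_betw G (arr M) (arr N)"
    and src_iso: "f \<in> arr M \<Longrightarrow> src N (G f) = map F (src M f)"
    and trg_iso: "f \<in> arr M \<Longrightarrow> trg N (G f) = F (trg M f)"
    and mcomp_iso: "composable M f fs \<Longrightarrow> G (mcomp M f fs) = mcomp N (G f) (map G fs)"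
begin

definition Ginv :: "'b \<Rightarrow> 'a" where
  "Ginv = inv_into (arr M) G"

lemma G_arr: "f \<in> arr M \<Longrightarrow> G f \<in> arr N"
  using bij_arr by (rule bij_betwE[rule_format])

lemma F_obj: "set As \<subseteq> obj M \<Longrightarrow> set (map F As) \<subseteq> obj N"
  using bij_betwE[OF bij_obj] by auto

lemma G_inj: "f \<in> arr M \<Longrightarrow> g \<in> arr M \<Longrightarrow> G f = G g \<Longrightarrow> f = g"
  using bij_betw_imp_inj_on[OF bij_arr] by (simp add: inj_on_eq_iff)

lemma G_Ginv: "g \<in> arr N \<Longrightarrow> G (Ginv g) = g"
  unfolding Ginv_def using bij_betw_inv_into_right[OF bij_arr] .

lemma Ginv_arr: "g \<in> arr N \<Longrightarrow> Ginv g \<in> arr M"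
  unfolding Ginv_def using bij_betwE[OF bij_betw_inv_into[OF bij_arr]] by blast

lemma G_hom: "f \<in> hom M As B \<Longrightarrow> G f \<in> hom N (map F As) (F B)"
  using G_arr src_iso trg_iso by (simp add: hom_def)

lemma Ginv_hom:
  assumes g: "g \<in> hom N (map F As) (F B)" and As: "set As \<subseteq> obj M" and B: "B \<in> obj M"
  shows "Ginv g \<in> hom M As B"
proof (rule homI)
  have arr: "Ginv g \<in> arr M" and G: "G (Ginv g) = g"
    using homD(1)[OF g] Ginv_arr G_Ginv by blast+
  show "Ginv g \<in> arr M" by (rule arr)
  have "map F (src M (Ginv g)) = map F As" "F (trg M (Ginv g)) = F B"
    using src_iso[OF arr] trg_iso[OF arr] homD[OF g] G by simp_all
  moreover have "inj_on F (set (src M (Ginv g)) \<union> set As)"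
    using bij_betw_imp_inj_on[OF bij_obj] M.src_obj[OF arr] As by (blast intro: inj_on_subset)
  ultimately show "src M (Ginv g) = As" "trg M (Ginv g) = B"
    using bij_betw_imp_inj_on[OF bij_obj] M.trg_obj[OF arr] B
    by (simp_all add: inj_on_map_eq_map inj_on_eq_iff)
qed

lemma composable_iso:
  assumes "composable M f fs"
  shows "composable N (G f) (map G fs)"
proof -
  have f: "f \<in> arr M" and fs: "set fs \<subseteq> arr M" and trg: "map (trg M) fs = src M f"
    using assms by (simp_all add: composable_def)
  have "map (trg N) (map G fs) = map F (map (trg M) fs)"
    using fs trg_iso by auto
  then show ?thesis
    using f fs G_arr src_iso[OF f] by (auto simp: composable_def trg)
qed

definition act :: "nat list \<Rightarrow> 'o list \<Rightarrow> 'a \<Rightarrow> 'a" where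
  "act \<sigma> Bs f = Ginv (actN \<sigma> (map F Bs) (G f))"

lemma acts_on_iso:
  assumes "acts_on M is_mapping \<sigma> Bs f"
  shows "acts_on N is_mapping \<sigma> (map F Bs) (G f)"
  using acts_on_mappingD[OF assms] F_obj G_arr src_iso map_nth_map[of \<sigma> Bs F]
  by (simp add: acts_on_def is_mapping_def)

lemma
  assumes "acts_on M is_mapping \<sigma> Bs f"
  shows act_hom: "act \<sigma> Bs f \<in> hom M Bs (trg M f)"
    and G_act: "G (act \<sigma> Bs f) = actN \<sigma> (map F Bs) (G f)"
proof -
  have hom: "actN \<sigma> (map F Bs) (G f) \<in> hom N (map F Bs) (F (trg M f))"
    using N.act_hom[OF acts_on_iso[OF assms]] trg_iso acts_on_mappingD(4)[OF assms] by simp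
  show "act \<sigma> Bs f \<in> hom M Bs (trg M f)"
    unfolding act_def
    by (rule Ginv_hom[OF hom acts_on_mappingD(1)[OF assms] M.trg_obj[OF acts_on_mappingD(4)[OF assms]]])
  show "G (act \<sigma> Bs f) = actN \<sigma> (map F Bs) (G f)"
    unfolding act_def by (rule G_Ginv[OF homD(1)[OF hom]])
qed

lemma map_length_src_iso:
  "set fs \<subseteq> arr M \<Longrightarrow> map (\<lambda>g. length (src N g)) (map G fs) = map (\<lambda>g. length (src M g)) fs"
  using src_iso by auto

lemma concat_src_iso:
  "set fs \<subseteq> arr M \<Longrightarrow> concat (map (src N) (map G fs)) = map F (concat (map (src M) fs))"
  unfolding map_concat map_map
  by (intro arg_cong[where f = concat] map_cong refl) (auto simp: src_iso)

text \<open>Each equation is tested after the injective \<open>G\<close>, where \<open>G_act\<close>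
  and \<open>mcomp_iso\<close> turn it into a law of \<open>N\<close>. \<open>G_act\<close> holds
  for legitimate actions, hence the typing facts before each computation.\<close>

lemma cartesian_action_iso: "cartesian_action M act"
proof (intro cartesian_action.intro mapping_action.intro mapping_action_axioms.intro M.multicategory_axioms)
  show "act \<sigma> Bs f \<in> hom M Bs (trg M f)" if "acts_on M is_mapping \<sigma> Bs f" for \<sigma> Bs f
    using that by (rule act_hom)
  show "act [0..<length (src M f)] (src M f) f = f" if f: "f \<in> arr M" for f
  proof -
    have "acts_on M is_mapping [0..<length (src M f)] (src M f) f"
      using f M.src_obj[OF f] by (auto simp: acts_on_def is_mapping_def map_nth)
    from act_hom[OF this] G_act[OF this] show ?thesis
      using N.act_id[OF G_arr[OF f]] src_iso[OF f] f by (auto intro: G_inj dest: homD(1))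
  qed
  show "act \<rho> Cs (act \<sigma> Bs f) = act (map ((!) \<rho>) \<sigma>) Cs f"
    if \<sigma>: "acts_on M is_mapping \<sigma> Bs f" and \<rho>: "acts_on M is_mapping \<rho> Cs (act \<sigma> Bs f)"
    for \<sigma> \<rho> Bs Cs f
  proof -
    note \<sigma>' = acts_on_mappingD[OF \<sigma>]
    have \<rho>': "set Cs \<subseteq> obj M" "set \<rho> \<subseteq> {..<length Cs}" "map ((!) Cs) \<rho> = Bs"
      using acts_on_mappingD[OF \<rho>] homD[OF act_hom[OF \<sigma>]] by simp_all
    have len: "length \<rho> = length Bs"
      using \<rho>'(3) by auto
    have "map ((!) Cs) (map ((!) \<rho>) \<sigma>) = src M f"
      using map_nth_map[of \<sigma> \<rho> "(!) Cs"] \<sigma>'(2,3) len unfolding \<rho>'(3) by simp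
    moreover have "\<rho> ! s < length Cs" if "s \<in> set \<sigma>" for s
      using subsetD[OF \<rho>'(2) nth_mem[of s \<rho>]] subsetD[OF \<sigma>'(2) that] len by simp
    ultimately have \<rho>\<sigma>: "acts_on M is_mapping (map ((!) \<rho>) \<sigma>) Cs f"
      using \<sigma>'(4) \<rho>'(1) by (auto simp: acts_on_def is_mapping_def)
    have "G (act \<rho> Cs (act \<sigma> Bs f)) = G (act (map ((!) \<rho>) \<sigma>) Cs f)"
      using N.act_act[OF acts_on_iso[OF \<sigma>]] acts_on_iso[OF \<rho>] G_act \<sigma> \<rho> \<rho>\<sigma> by simp
    then show ?thesis
      by (rule G_inj[OF homD(1)[OF act_hom[OF \<rho>]] homD(1)[OF act_hom[OF \<rho>\<sigma>]]])
  qed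
  show "mcomp M f (map (\<lambda>i. act (\<sigma>s ! i) (Bss ! i) (fs ! i)) [0..<length fs]) =
      act (juxtapose (map length Bss) \<sigma>s) (concat Bss) (mcomp M f fs)"
    if f: "composable M f fs" and len: "length \<sigma>s = length fs" "length Bss = length fs"
      and acts: "\<And>i. i < length fs \<Longrightarrow> acts_on M is_mapping (\<sigma>s ! i) (Bss ! i) (fs ! i)"
    for f fs \<sigma>s Bss
  proof -
    let ?J = "juxtapose (map length Bss) \<sigma>s"
    let ?hs = "map (\<lambda>i. act (\<sigma>s ! i) (Bss ! i) (fs ! i)) [0..<length fs]"
    have J: "acts_on M is_mapping ?J (concat Bss) (mcomp M f fs)"
      by (rule acts_on_mappingI[OF M.mcomp_hom[OF f] acts_on_juxtapose[OF len acts]])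
    have "set ?hs \<subseteq> arr M"
      using homD(1)[OF act_hom[OF acts]] by auto
    moreover have "map (trg M) ?hs = map (trg M) fs"
      by (rule nth_equalityI) (use homD(3)[OF act_hom[OF acts]] in simp_all)
    ultimately have hs: "composable M f ?hs"
      using f by (simp add: composable_def)
    have "map G ?hs = map (\<lambda>i. actN (\<sigma>s ! i) (map (map F) Bss ! i) (map G fs ! i))
        [0..<length (map G fs)]"
      by (rule nth_equalityI) (use G_act[OF acts] len in simp_all)
    then have "G (mcomp M f ?hs) =
        mcomp N (G f) (map (\<lambda>i. actN (\<sigma>s ! i) (map (map F) Bss ! i) (map G fs ! i))
          [0..<length (map G fs)])"
      unfolding mcomp_iso[OF hs] by (rule arg_cong)
    also have "\<dots> = actN (juxtapose (map length (map (map F) Bss)) \<sigma>s) (concat (map (map F) Bss))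
        (mcomp N (G f) (map G fs))"
      by (rule N.mcomp_act_right[OF composable_iso[OF f]])
        (use acts_on_iso[OF acts] len in simp_all)
    also have "\<dots> = actN ?J (map F (concat Bss)) (G (mcomp M f fs))"
      by (simp only: mcomp_iso[OF f] map_concat map_map comp_def length_map)
    also have "\<dots> = G (act ?J (concat Bss) (mcomp M f fs))"
      using G_act[OF J] by simp
    finally show ?thesis
      by (rule G_inj[OF homD(1)[OF M.mcomp_hom[OF hs]] homD(1)[OF act_hom[OF J]]])
  qed
  show "mcomp M (act \<sigma> Bs f) fs =
      act (block_mapping (map (\<lambda>g. length (src M g)) fs) \<sigma>) (concat (map (src M) fs))
        (mcomp M f (map ((!) fs) \<sigma>))"
    if f: "acts_on M is_mapping \<sigma> Bs f" and fs: "set fs \<subseteq> arr M" and Bs: "map (trg M) fs = Bs"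
    for \<sigma> Bs f fs
  proof -
    let ?bm = "block_mapping (map (\<lambda>g. length (src M g)) fs) \<sigma>" and ?gs = "map ((!) fs) \<sigma>"
    let ?Xs = "concat (map (src M) fs)"
    note b = acts_on_block_mapping[OF f Bs]
    have gs: "composable M f ?gs"
      using acts_on_mappingD(4)[OF f] b(3,4) fs by (auto simp: composable_def)
    have act_fs: "composable M (act \<sigma> Bs f) fs"
      using homD[OF act_hom[OF f]] fs Bs by (simp add: composable_def)
    have "set ?Xs \<subseteq> obj M"
      using fs M.src_obj by fastforce
    note bm = acts_on_mappingI[OF M.mcomp_hom[OF gs] this b(1,2)]
    have Gfs: "set (map G fs) \<subseteq> arr N" "map (trg N) (map G fs) = map F Bs"
      using composable_iso[OF act_fs] homD[OF act_hom[OF f]] src_iso by (simp_all add: composable_def)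
    have "set \<sigma> \<subseteq> {..<length fs}"
      using b(3) by auto
    note nth = map_nth_map[OF this, of G]
    have "G (mcomp M (act \<sigma> Bs f) fs) = mcomp N (actN \<sigma> (map F Bs) (G f)) (map G fs)"
      using mcomp_iso[OF act_fs] G_act[OF f] by simp
    also have "\<dots> = actN ?bm (map F ?Xs) (G (mcomp M f ?gs))"
      by (simp only: N.mcomp_act_left[OF acts_on_iso[OF f] Gfs] map_length_src_iso[OF fs]
          concat_src_iso[OF fs] nth mcomp_iso[OF gs])
    also have "\<dots> = G (act ?bm ?Xs (mcomp M f ?gs))"
      using G_act[OF bm] by simp
    finally show ?thesis
      by (rule G_inj[OF homD(1)[OF M.mcomp_hom[OF act_fs]] homD(1)[OF act_hom[OF bm]]])
  qed
qed

text \<open>Universal products are defined by composition alone, so the bijections match cones over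
  \<open>As\<close> in \<open>M\<close> with cones over \<open>map F As\<close> in \<open>N\<close>,
  together with their factorisations.\<close>

lemma has_universal_products_iso:
  assumes "has_universal_products N"
  shows "has_universal_products M"
  unfolding has_universal_products_def
proof (intro allI impI)
  fix As assume As: "set As \<subseteq> obj M"
  then obtain D qs where D: "universal_product N (map F As) D qs"
    using assms F_obj by (meson has_universal_products_def)
  have "D \<in> F ` obj M"
    using N.universal_product_proj(1)[OF D] bij_betw_imp_surj_on[OF bij_obj] by simp
  then obtain C where C: "C \<in> obj M" "D = F C"
    by blast
  let ?ps = "map Ginv qs"
  have qs: "cone N (map F [C]) qs (map F As)"
    using N.universal_product_proj(2)[OF D] C by simp
  have ps: "cone M [C] ?ps As"
  proof (rule list_all2_all_nthI)
    fix i assume "i < length ?ps"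
    then have i: "i < length As"
      using list_all2_lengthD[OF qs] by simp
    then have "qs ! i \<in> hom N (map F [C]) (F (As ! i))"
      using list_all2_nthD2[OF qs, of i] by simp
    moreover have "As ! i \<in> obj M"
      using As i by auto
    ultimately show "?ps ! i \<in> hom M [C] (As ! i)"
      using Ginv_hom C(1) i list_all2_lengthD[OF qs] by simp
  qed (use list_all2_lengthD[OF qs] in simp)
  have "set qs \<subseteq> arr N"
    using qs by (rule cone_arr)
  then have G_ps: "map G ?ps = qs"
    using G_Ginv by (auto intro!: map_idI)
  have comp: "map G (map (\<lambda>p. mcomp M p [t]) ?ps) = map (\<lambda>q. mcomp N q [G t]) qs"
    if t: "t \<in> hom M Xs C" for t Xs
  proof -
    have "G (mcomp M p [t]) = mcomp N (G p) [G t]" if p: "p \<in> set ?ps" for p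
    proof -
      obtain i where "i < length ?ps" "p = ?ps ! i"
        using p unfolding in_set_conv_nth by metis
      then have "p \<in> hom M [C] (As ! i)"
        using list_all2_nthD[OF ps] by metis
      then show ?thesis
        using mcomp_iso[of p "[t]"] homD[OF t] by (simp add: composable_def hom_def)
    qed
    then have "map G (map (\<lambda>p. mcomp M p [t]) ?ps) = map (\<lambda>q. mcomp N q [G t]) (map G ?ps)"
      unfolding map_map by (intro map_cong refl) auto
    then show ?thesis
      by (simp only: G_ps)
  qed
  have "universal_product M As C ?ps"
  proof (rule M.universal_productI[OF C(1) ps])
    fix Xs fs
    assume Xs: "set Xs \<subseteq> obj M" and fs: "cone M Xs fs As"
    have "cone N (map F Xs) (map G fs) (map F As)"
      using fs G_hom by (simp add: list_all2_conv_all_nth)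
    then obtain s where s: "s \<in> hom N (map F Xs) D" "map (\<lambda>q. mcomp N q [s]) qs = map G fs"
      by (rule N.universal_product_exists[OF D F_obj[OF Xs]])
    have t: "Ginv s \<in> hom M Xs C"
      using Ginv_hom[of s Xs C] s(1) C Xs by simp
    have Gt: "G (Ginv s) = s"
      by (rule G_Ginv[OF homD(1)[OF s(1)]])
    have "map G (map (\<lambda>p. mcomp M p [Ginv s]) ?ps) = map G fs"
      using comp[OF t] Gt s(2) by simp
    moreover have "set (map (\<lambda>p. mcomp M p [Ginv s]) ?ps) \<union> set fs \<subseteq> arr M"
      using cone_arr[OF M.cone_mcomp[OF ps t]] cone_arr[OF fs] by simp
    then have "inj_on G (set (map (\<lambda>p. mcomp M p [Ginv s]) ?ps) \<union> set fs)"
      using bij_betw_imp_inj_on[OF bij_arr] by (rule inj_on_subset[rotated])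
    ultimately have "map (\<lambda>p. mcomp M p [Ginv s]) ?ps = fs"
      by (simp only: inj_on_map_eq_map)
    with t show "\<exists>t. t \<in> hom M Xs C \<and> map (\<lambda>p. mcomp M p [t]) ?ps = fs"
      by blast
  next
    fix Xs t t'
    assume t: "t \<in> hom M Xs C" "t' \<in> hom M Xs C"
      and eq: "map (\<lambda>p. mcomp M p [t]) ?ps = map (\<lambda>p. mcomp M p [t']) ?ps"
    have "map (\<lambda>q. mcomp N q [G t]) qs = map (\<lambda>q. mcomp N q [G t']) qs"
      using arg_cong[OF eq, of "map G"] unfolding comp[OF t(1)] comp[OF t(2)] .
    then have "G t = G t'"
      using N.universal_product_ext[OF D] G_hom t C(2) by blast
    then show "t = t'"
      by (rule G_inj[OF homD(1)[OF t(1)] homD(1)[OF t(2)]])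
  qed
  then show "\<exists>C ps. universal_product M As C ps"
    by blast
qed

end

section \<open>Assembling the equivalences\<close>

lemma (in fp_category) has_universal_products_times: "has_universal_products N"
  using universal_product_times by (auto simp: has_universal_products_def)

lemma cartesian_structure_action: "cartesian_structure M act \<Longrightarrow> cartesian_action M act"
  by (simp add: cartesian_structure_def cartesian_action_def)

text \<open>The conclusion concerns \<open>M\<close> alone, so \<open>C\<close> may live on
  unrelated types. Representability is reached through universal products, which transport
  directly.\<close>

lemma is_cartesian_representable_if_isomorphic:
  fixes M :: "('o, 'a, 'z) symmetric_multicategory_scheme"
    and C :: "('p, 'b, 'y) fp_category_scheme"
  assumes M: "symmetric_multicategory M" and C: "fp_category C"
    and iso: "isomorphic M (times_multicategory C)"
  shows "is_cartesian M \<and> representable M"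
proof -
  interpret M: symmetric_multicategory M by (rule M)
  interpret C: fp_category C by (rule C)
  obtain F G where FG: "bij_betw F (obj M) (obj C.N)" "bij_betw G (arr M) (arr C.N)"
    "\<And>f. f \<in> arr M \<Longrightarrow> src C.N (G f) = map F (src M f)"
    "\<And>f. f \<in> arr M \<Longrightarrow> trg C.N (G f) = F (trg M f)"
    "\<And>f fs. composable M f fs \<Longrightarrow> G (mcomp M f fs) = mcomp C.N (G f) (map G fs)"
    and perm: "\<And>\<sigma> Bs f. acts_on M is_bijection \<sigma> Bs f \<Longrightarrow>
      G (perm M \<sigma> Bs f) = perm C.N \<sigma> (map F Bs) (G f)"
    using iso unfolding isomorphic_def by blast
  interpret iso: multicategory_iso M C.N "perm C.N" F G
    by (intro multicategory_iso.intro multicategory_iso_axioms.intro M.multicategory_axioms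
        C.cartesian_action_times FG)
  interpret act: cartesian_action M iso.act
    by (rule iso.cartesian_action_iso)
  \<comment> \<open>Both sides have the same image under \<open>G\<close>: the transported action
    comes from \<open>perm N\<close>, which the isomorphism matches with \<open>perm M\<close> on
    bijections.\<close>
  have "iso.act \<sigma> Bs f = perm M \<sigma> Bs f" if "acts_on M is_bijection \<sigma> Bs f" for \<sigma> Bs f
  proof (rule iso.G_inj)
    have acts: "acts_on M is_mapping \<sigma> Bs f"
      using that by (simp add: acts_on_def is_bijection_def is_mapping_def)
    show "iso.act \<sigma> Bs f \<in> arr M" "perm M \<sigma> Bs f \<in> arr M"
      by (rule homD(1)[OF iso.act_hom[OF acts]], rule homD(1)[OF M.act_hom[OF that]])
    show "G (iso.act \<sigma> Bs f) = G (perm M \<sigma> Bs f)"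
      using iso.G_act[OF acts] perm[OF that] by simp
  qed
  then have "is_cartesian M"
    using act.mapping_action_axioms by (auto simp: is_cartesian_def cartesian_structure_def)
  moreover have "representable M"
    using iso.has_universal_products_iso C.has_universal_products_times
      act.has_universal_products_iff act.representable_iff by blast
  ultimately show ?thesis ..
qed

lemma isomorphic_if_has_algebraic_products:
  fixes M :: "('o, 'a, 'z) symmetric_multicategory_scheme"
  assumes act: "cartesian_structure M act" and alg: "has_algebraic_products M act"
  shows "\<exists>C :: ('o, 'a) fp_category. fp_category C \<and> isomorphic M (times_multicategory C)"
proof -
  interpret cartesian_action M act
    by (rule cartesian_structure_action[OF act])
  obtain P pr pair where "\<And>As. set As \<subseteq> obj M \<Longrightarrow> algebraic_product M act As (P As) (pr As) (pair As)"
    using alg unfolding has_algebraic_products_def by metis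
  then interpret chosen_products M act P pr pair
    by unfold_locales
  have "isomorphic M fp.N"
    unfolding isomorphic_def
  proof (intro exI conjI ballI allI impI)
    show "bij_betw (\<lambda>A. A) (obj M) (obj fp.N)"
      by (simp add: bij_betw_def)
    show "bij_betw rep (arr M) (arr fp.N)"
      by (rule rep_bij)
    show "src fp.N (rep f) = map (\<lambda>A. A) (src M f)" "trg fp.N (rep f) = trg M f"
      if "f \<in> arr M" for f
      using homD(3)[OF factor_hom[OF homI[OF that refl refl]]] by simp_all
    show "rep (ident M A) = ident fp.N A" if "A \<in> obj M" for A
      using that by (rule rep_ident)
    show "rep (mcomp M f fs) = mcomp fp.N (rep f) (map rep fs)" if "composable M f fs" for f fs
      using that by (rule rep_mcomp)
    \<comment> \<open>On bijections \<open>perm M\<close> agrees with \<open>act\<close>, for which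
      \<open>rep_act\<close> holds along every mapping.\<close>
    show "rep (perm M \<sigma> Bs f) = perm fp.N \<sigma> (map (\<lambda>A. A) Bs) (rep f)"
      if "acts_on M is_bijection \<sigma> Bs f" for \<sigma> Bs f
    proof -
      have "acts_on M is_mapping \<sigma> Bs f"
        using that by (simp add: acts_on_def is_bijection_def is_mapping_def)
      note acts = acts_on_mappingD[OF this]
      show ?thesis
        using rep_act[OF homI[OF acts(4) refl refl] acts(1-3)] act that
        by (simp add: cartesian_structure_def)
    qed
  qed
  then show ?thesis
    using fp.fp_category_axioms by blast
qed

theorem corollary4p10:
  fixes M :: "('o, 'a) symmetric_multicategory"
  assumes "symmetric_multicategory M"
  shows "((\<exists>act. cartesian_structure M act \<and> has_algebraic_products M act)
            \<longleftrightarrow> (is_cartesian M \<and> has_universal_products M))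
       \<and> ((is_cartesian M \<and> has_universal_products M)
            \<longleftrightarrow> (is_cartesian M \<and> representable M))
       \<and> ((is_cartesian M \<and> representable M)
            \<longleftrightarrow> (\<exists>C :: ('o, 'a) fp_category.
                   fp_category C \<and> isomorphic M (times_multicategory C)))
       \<and> ((\<exists>C :: ('p, 'b) fp_category.
                   fp_category C \<and> isomorphic M (times_multicategory C))
            \<longrightarrow> (is_cartesian M \<and> representable M))"
proof -
  \<comment> \<open>Both conditions are compared with algebraic products for the same action, so any
    cartesian structure that witnesses condition 2 or 3 also witnesses condition 1.\<close>
  have "has_universal_products M \<longleftrightarrow> has_algebraic_products M act"
    "representable M \<longleftrightarrow> has_algebraic_products M act" if "cartesian_structure M act" for act
  proof -
    interpret cartesian_action M act
      by (rule cartesian_structure_action[OF that])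
    show "has_universal_products M \<longleftrightarrow> has_algebraic_products M act"
      "representable M \<longleftrightarrow> has_algebraic_products M act"
      by (rule has_universal_products_iff, rule representable_iff)
  qed
  moreover have "\<exists>C :: ('o, 'a) fp_category. fp_category C \<and> isomorphic M (times_multicategory C)"
    if "cartesian_structure M act" "has_algebraic_products M act" for act
    using isomorphic_if_has_algebraic_products that .
  moreover have "is_cartesian M \<and> representable M"
    if "fp_category C" "isomorphic M (times_multicategory C)" for C :: "('o, 'a) fp_category"
    using is_cartesian_representable_if_isomorphic[OF assms that] .
  \<comment> \<open>This instance covers a witnessing category on types unrelated to those of
    \<open>M\<close>.\<close>
  moreover have "is_cartesian M \<and> representable M"
    if "fp_category C" "isomorphic M (times_multicategory C)" for C :: "('p, 'b) fp_category"
    using is_cartesian_representable_if_isomorphic[OF assms that] .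
  ultimately show ?thesis
    unfolding is_cartesian_def by meson
qed

end
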